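(* Let $r\in\mathbb{N}$, $n\in\mathbb{N}$, $\alpha\in\mathbb{N}$, let $p,q>1$ with $\frac1p+\frac1q=1$, and let $\beta>\frac{1}{\alpha}\left(\frac1p+n+r\right)$. Let $f\in C^{n}(\mathbb{R})$ with $f^{(n)}\in L_p(\mathbb{R})$, and let $\xi>0$. Then $$\|\Delta(x)\|_p\le \frac{(2\alpha)^{\frac1p}\,\Gamma(\beta)\,\Gamma\left(\frac{q\beta}{2}-\frac{1}{2\alpha}\right)^{\frac1q}\,\xi^{n}\,\tau^{\frac1p}}{\Gamma\left(\frac{q\beta}{2}\right)^{\frac1q}\,\Gamma\left(\frac{1}{2\alpha}\right)^{\frac1p}\,\Gamma\left(\beta-\frac{1}{2\alpha}\right)\,(rp+1)^{\frac1p}\,(n-1)!\,(q(n-1)+1)^{1/q}}\;\omega_r(f^{(n)},\xi)_p,$$ where $$0<\tau:=\int_0^\infty (1+u)^{rp+1}\frac{u^{np-1}}{(u^{2\alpha}+1)^{p\beta/2}}\,du-\int_0^\infty\frac{u^{np-1}}{(u^{2\alpha}+1)^{p\beta/2}}\,du<\infty.$$ Hence $\|\Delta(x)\|_p\to0$ as $\xi\to0$. If additionally $f^{(2m)}\in L_p(\mathbb{R})$ for $m=1,\dots,\lfloor n/2\rfloor$, then $\|M_{r,\xi}(f)-f\|_p\to0$ as $\xi\to0$.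
   Context: For $r\in\mathbb{N}$ and $n\in\mathbb{Z}_+$ set $\alpha_j=(-1)^{r-j}\binom{r}{j}j^{-n}$ for $j=1,\dots,r$ and $\alpha_0=1-\sum_{j=1}^r(-1)^{r-j}\binom{r}{j}j^{-n}$, so $\sum_{j=0}^r\alpha_j=1$. For $\alpha\in\mathbb{N}$, $\beta>\frac{1}{2\alpha}$, $\xi>0$, let $W=\frac{\Gamma(\beta)\alpha\xi^{2\alpha\beta-1}}{\Gamma(\frac{1}{2\alpha})\Gamma(\beta-\frac{1}{2\alpha})}$ and define the smooth Poisson-Cauchy type singular integral operator $M_{r,\xi}(f;x)=W\int_{-\infty}^{\infty}\frac{\sum_{j=0}^r\alpha_jf(x+jt)}{(t^{2\alpha}+\xi^{2\alpha})^{\beta}}dt$, $x\in\mathbb{R}$. Let $\delta_k=\sum_{j=1}^r\alpha_j j^k$ and $$\Delta(x):=M_{r,\xi}(f;x)-f(x)-\sum_{m=1}^{\lfloor n/2\rfloor}\frac{f^{(2m)}(x)\delta_{2m}}{(2m)!}\frac{\Gamma(\frac{2m+1}{2\alpha})\Gamma(\beta-\frac{2m+1}{2\alpha})}{\Gamma(\frac{1}{2\alpha})\Gamma(\beta-\frac{1}{2\alpha})}\xi^{2m}$$ (the sum is empty if $n=1$). For $g\in L_p(\mathbb{R})$, $\Delta_t^rg(x)=\sum_{j=0}^r(-1)^{r-j}\binom{r}{j}g(x+jt)$ and the $r$th $L_p$-modulus of smoothness is $\omega_r(g,h)_p=\sup_{|t|\le h}\|\Delta_t^rg(x)\|_{p,x}$,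 $h>0$. $\|\cdot\|_p$ denotes the $L_p(\mathbb{R})$ norm in the variable $x$. *)

theory Defs
  imports "HOL-Analysis.Analysis"
begin

definition Lp_norm :: "real \<Rightarrow> (real \<Rightarrow> real) \<Rightarrow> ennreal" where
  "Lp_norm p g =
     (let I = (\<integral>\<^sup>+ x. ennreal (\<bar>g x\<bar> powr p) \<partial>lborel)
      in if I = \<infinity> then \<infinity> else ennreal (enn2real I powr (1 / p)))"

definition in_Lp :: "real \<Rightarrow> (real \<Rightarrow> real) \<Rightarrow> bool" where
  "in_Lp p g \<longleftrightarrow> g \<in> borel_measurable lborel \<and> Lp_norm p g < \<infinity>"

definition C_n :: "nat \<Rightarrow> (real \<Rightarrow> real) \<Rightarrow> bool" where
  "C_n n f \<longleftrightarrow> (\<forall>k<n. \<forall>x. (deriv ^^ k) f differentiable (at x))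
                 \<and> continuous_on UNIV ((deriv ^^ n) f)"

definition fwd_diff :: "nat \<Rightarrow> real \<Rightarrow> (real \<Rightarrow> real) \<Rightarrow> real \<Rightarrow> real" where
  "fwd_diff r t g x = (\<Sum>j=0..r. (-1) ^ (r - j) * real (r choose j) * g (x + real j * t))"

definition omega_mod :: "nat \<Rightarrow> real \<Rightarrow> (real \<Rightarrow> real) \<Rightarrow> real \<Rightarrow> ennreal" where
  "omega_mod r p g h = (SUP t\<in>{t. \<bar>t\<bar> \<le> h}. Lp_norm p (fwd_diff r t g))"

definition alpha_coef :: "nat \<Rightarrow> nat \<Rightarrow> nat \<Rightarrow> real" where
  "alpha_coef r n j =
     (if j = 0 then 1 - (\<Sum>i=1..r. (-1) ^ (r - i) * real (r choose i) * (real i) powi (- int n))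
      else (-1) ^ (r - j) * real (r choose j) * (real j) powi (- int n))"

definition delta_coef :: "nat \<Rightarrow> nat \<Rightarrow> nat \<Rightarrow> real" where
  "delta_coef r n k = (\<Sum>j=1..r. alpha_coef r n j * real j ^ k)"

definition W_const :: "nat \<Rightarrow> real \<Rightarrow> real \<Rightarrow> real" where
  "W_const \<alpha> \<beta> \<xi> = Gamma \<beta> * real \<alpha> * \<xi> powr (2 * real \<alpha> * \<beta> - 1)
      / (Gamma (1 / (2 * real \<alpha>)) * Gamma (\<beta> - 1 / (2 * real \<alpha>)))"

definition M_op :: "nat \<Rightarrow> nat \<Rightarrow> nat \<Rightarrow> real \<Rightarrow> real \<Rightarrow> (real \<Rightarrow> real) \<Rightarrow> real \<Rightarrow> real" where
  "M_op r n \<alpha> \<beta> \<xi> f x = W_const \<alpha> \<beta> \<xi> *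
     (LINT t|lborel. (\<Sum>j=0..r. alpha_coef r n j * f (x + real j * t))
                      / (t ^ (2 * \<alpha>) + \<xi> ^ (2 * \<alpha>)) powr \<beta>)"

definition Delta_err :: "nat \<Rightarrow> nat \<Rightarrow> nat \<Rightarrow> real \<Rightarrow> real \<Rightarrow> (real \<Rightarrow> real) \<Rightarrow> real \<Rightarrow> real" where
  "Delta_err r n \<alpha> \<beta> \<xi> f x = M_op r n \<alpha> \<beta> \<xi> f x - f x
     - (\<Sum>m=1..n div 2. (deriv ^^ (2 * m)) f x * delta_coef r n (2 * m) / fact (2 * m)
         * (Gamma ((2 * real m + 1) / (2 * real \<alpha>)) * Gamma (\<beta> - (2 * real m + 1) / (2 * real \<alpha>)))
         / (Gamma (1 / (2 * real \<alpha>)) * Gamma (\<beta> - 1 / (2 * real \<alpha>))) * \<xi> ^ (2 * m))"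

definition tau_int1 :: "nat \<Rightarrow> nat \<Rightarrow> nat \<Rightarrow> real \<Rightarrow> real \<Rightarrow> real \<Rightarrow> real" where
  "tau_int1 r n \<alpha> \<beta> p u = (1 + u) powr (real r * p + 1) * u powr (real n * p - 1)
       / (u ^ (2 * \<alpha>) + 1) powr (p * \<beta> / 2)"

definition tau_int2 :: "nat \<Rightarrow> nat \<Rightarrow> real \<Rightarrow> real \<Rightarrow> real \<Rightarrow> real" where
  "tau_int2 n \<alpha> \<beta> p u = u powr (real n * p - 1) / (u ^ (2 * \<alpha>) + 1) powr (p * \<beta> / 2)"

definition tau_const :: "nat \<Rightarrow> nat \<Rightarrow> nat \<Rightarrow> real \<Rightarrow> real \<Rightarrow> real" where
  "tau_const r n \<alpha> \<beta> p = (LBINT u:{0<..}. tau_int1 r n \<alpha> \<beta> p u) - (LBINT u:{0<..}. tau_int2 n \<alpha> \<beta> p u)"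

definition bound_const :: "nat \<Rightarrow> nat \<Rightarrow> nat \<Rightarrow> real \<Rightarrow> real \<Rightarrow> real \<Rightarrow> real \<Rightarrow> real" where
  "bound_const r n \<alpha> \<beta> p q \<xi> =
     ((2 * real \<alpha>) powr (1 / p) * Gamma \<beta> * Gamma (q * \<beta> / 2 - 1 / (2 * real \<alpha>)) powr (1 / q)
       * \<xi> ^ n * tau_const r n \<alpha> \<beta> p powr (1 / p))
   / (Gamma (q * \<beta> / 2) powr (1 / q) * Gamma (1 / (2 * real \<alpha>)) powr (1 / p)
       * Gamma (\<beta> - 1 / (2 * real \<alpha>)) * (real r * p + 1) powr (1 / p) * fact (n - 1)
       * (q * (real n - 1) + 1) powr (1 / q))"

end

theory Submission
  imports Defs
begin

text \<open>
  Substituting \<open>t = \<xi> u\<close> turns the kernel into \<open>(u\<^sup>2\<^sup>\<alpha> + 1) powr (- \<beta>)\<close>. Since \<open>\<alpha>\<^sub>j j\<^sup>n\<close> is the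
  signed binomial coefficient, the Taylor formula with integral remainder gives
  \<open>\<Sum>\<^sub>j \<alpha>\<^sub>j f(x + j t) - f(x) - \<Sum>\<^sub>k \<delta>\<^sub>k f\<^sup>(\<^sup>k\<^sup>)(x) t\<^sup>k / k! =
    t\<^sup>n / (n - 1)! \<integral>\<^sub>0\<^sup>1 (1 - s)\<^sup>n\<^sup>-\<^sup>1 (\<Delta>\<^sup>r\<^sub>s\<^sub>t f\<^sup>(\<^sup>n\<^sup>))(x) ds\<close>.
  Against the even kernel the odd powers of \<open>t\<close> vanish and the even ones give Beta integrals, so
  the error is the integral of this remainder. Hoelder's inequality in \<open>s\<close> and in \<open>u\<close> (splitting the
  kernel into two square roots), Tonelli's theorem and
  \<open>\<omega>\<^sub>r(h, \<lambda> \<xi>) \<le> (1 + \<lambda>)\<^sup>r \<omega>\<^sub>r(h, \<xi>)\<close> then yield the stated constant.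
\<close>

section \<open>Powers of \<open>L\<^sub>p\<close> norms and moduli of smoothness\<close>

text \<open>Each factor of the constant has one source. The \<open>L\<^sub>q\<close> norm of
  \<open>(1 - s) ^ (n - 1)\<close> on the unit interval is
  \<open>(q (n - 1) + 1) powr (- 1 / q)\<close>. Integrating \<open>(1 + s u) powr (r p)\<close>
  over \<open>s\<close> gives \<open>((1 + u) powr (r p + 1) - 1) / ((r p + 1) u)\<close>: hence the
  difference of two integrals in \<tau>, the factor \<open>r p + 1\<close>, and the exponent
  \<open>n p - 1\<close> where \<open>n p\<close> might be expected. The square roots of the kernel,
  raised to the powers \<open>p\<close> and \<open>q\<close>, have exponents
  \<open>p \<beta> / 2\<close> (in \<tau>) and \<open>q \<beta> / 2\<close> (in the Gamma quotient).
  The obstacle is integrability: no growth bound is assumed on \<open>f\<close> itself, so the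
  Bochner integral in \<open>M_op\<close> is not known in advance to exist at a given
  \<open>x\<close>, and it would silently be 0 if it did not. The estimates are therefore made for
  \<open>p\<close>-th powers with nonnegative extended integrals. Finiteness of the double integral
  over \<open>x\<close> and \<open>u\<close> then yields integrability for almost every
  \<open>x\<close>, which is all that an \<open>L\<^sub>p\<close> norm sees.\<close>

lemma nn_integral_Holder:
  fixes a b :: "'a \<Rightarrow> real"
  assumes [measurable]: "a \<in> borel_measurable M" "b \<in> borel_measurable M"
    and nonneg: "\<And>x. 0 \<le> a x" "\<And>x. 0 \<le> b x"
    and p: "p > 1" and q: "q > 1" and pq: "1 / p + 1 / q = 1"
    and A: "(\<integral>\<^sup>+ x. ennreal (a x powr p) \<partial>M) = ennreal A" "0 \<le> A"
    and B: "(\<integral>\<^sup>+ x. ennreal (b x powr q) \<partial>M) = ennreal B" "0 \<le> B"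
  shows "(\<integral>\<^sup>+ x. ennreal (a x * b x) \<partial>M) \<le> ennreal (A powr (1 / p) * B powr (1 / q))"
proof (cases "A = 0 \<or> B = 0")
  case True
  have "AE x in M. a x * b x = 0"
  proof (cases "A = 0")
    case True
    then have "AE x in M. ennreal (a x powr p) = 0"
      using A by (subst nn_integral_0_iff_AE[symmetric]) auto
    then show ?thesis by eventually_elim (auto simp: ennreal_eq_0_iff powr_eq_0_iff dest: antisym)
  next
    case False
    with \<open>A = 0 \<or> B = 0\<close> have "AE x in M. ennreal (b x powr q) = 0"
      using B by (subst nn_integral_0_iff_AE[symmetric]) auto
    then show ?thesis by eventually_elim (auto simp: ennreal_eq_0_iff powr_eq_0_iff dest: antisym)
  qed
  then have "(\<integral>\<^sup>+ x. ennreal (a x * b x) \<partial>M) = (\<integral>\<^sup>+ x. 0 \<partial>M)"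
    by (intro nn_integral_cong_AE) (auto elim: eventually_mono)
  then show ?thesis by simp
next
  case False
  with A B have pos: "A > 0" "B > 0" by auto
  define S where "S = A powr (1 / p)"
  define T where "T = B powr (1 / q)"
  have ST: "S > 0" "T > 0" using pos by (auto simp: S_def T_def)
  have Sp: "S powr p = A" "T powr q = B" using pos p q by (auto simp: S_def T_def powr_powr)
  \<comment> \<open>Young's inequality for the factors normalised by their norms \<open>S\<close>
    and \<open>T\<close>; this division is why vanishing norms were split off. After integration the
    two terms add up to \<open>S * T * (1 / p + 1 / q)\<close>.\<close>
  have young: "a x * b x \<le> S * T / (p * A) * (a x powr p) + S * T / (q * B) * (b x powr q)" for x
  proof -
    have "(a x / S) * (b x / T) \<le> (a x / S) powr p / p + (b x / T) powr q / q"
      by (rule Youngs_inequality) (use p q pq nonneg ST in auto)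
    also have "\<dots> = a x powr p / (p * A) + b x powr q / (q * B)"
      using ST nonneg Sp by (simp add: powr_divide mult.commute)
    finally have "S * T * ((a x / S) * (b x / T)) \<le> S * T * (a x powr p / (p * A) + b x powr q / (q * B))"
      using ST by (intro mult_left_mono) auto
    then show ?thesis using ST by (simp add: field_simps)
  qed
  have "(\<integral>\<^sup>+ x. ennreal (a x * b x) \<partial>M)
      \<le> (\<integral>\<^sup>+ x. ennreal (S * T / (p * A)) * ennreal (a x powr p) + ennreal (S * T / (q * B)) * ennreal (b x powr q) \<partial>M)"
    using pos ST p q young
    by (intro nn_integral_mono) (simp add: ennreal_mult[symmetric] ennreal_plus[symmetric] del: ennreal_plus)
  also have "\<dots> = ennreal (S * T / (p * A)) * ennreal A + ennreal (S * T / (q * B)) * ennreal B"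
    by (subst nn_integral_add) (auto simp: nn_integral_cmult A B)
  also have "\<dots> = ennreal (S * T / (p * A) * A + S * T / (q * B) * B)"
    using pos ST p q by (simp add: ennreal_mult[symmetric] ennreal_plus[symmetric] del: ennreal_plus)
  also have "S * T / (p * A) * A + S * T / (q * B) * B = S * T * (1 / p + 1 / q)"
    using pos p q by (simp add: field_simps)
  finally show ?thesis using pq by (simp add: S_def T_def)
qed

text \<open>Jensen's inequality for \<open>x powr p\<close>. The zero terms are dropped first, so
  that convexity is used at positive arguments only; this lowers the cardinality, which is harmless
  since \<open>p \<ge> 1\<close>.\<close>

lemma power_mean_powr:
  fixes a :: "'i \<Rightarrow> real"
  assumes "finite I" "p \<ge> 1"
  shows "\<bar>\<Sum>i\<in>I. a i\<bar> powr p \<le> real (card I) powr (p - 1) * (\<Sum>i\<in>I. \<bar>a i\<bar> powr p)"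
proof (cases "\<exists>i\<in>I. a i \<noteq> 0")
  case True
  define J where "J = {i \<in> I. a i \<noteq> 0}"
  have J: "finite J" "J \<noteq> {}" "J \<subseteq> I" using True assms by (auto simp: J_def)
  define N where "N = real (card J)"
  have N: "N > 0" using J by (simp add: N_def card_gt_0_iff)
  have "(\<Sum>i\<in>J. (1 / N) *\<^sub>R \<bar>a i\<bar>) powr p \<le> (\<Sum>i\<in>J. (1 / N) * \<bar>a i\<bar> powr p)"
    using N assms J
    by (intro convex_on_sum[of _ _ _ "\<lambda>i. 1/N", OF _ _ powr_convex]) (auto simp: N_def J_def)
  then have "((\<Sum>i\<in>J. \<bar>a i\<bar>) / N) powr p \<le> (\<Sum>i\<in>J. \<bar>a i\<bar> powr p) / N"
    by (simp add: sum_divide_distrib)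
  then have "(\<Sum>i\<in>J. \<bar>a i\<bar>) powr p \<le> N powr p / N * (\<Sum>i\<in>J. \<bar>a i\<bar> powr p)"
    using N by (simp add: powr_divide sum_nonneg field_simps)
  also have "N powr p / N = N powr (p - 1)" using N by (simp add: powr_diff)
  also have "N powr (p - 1) \<le> real (card I) powr (p - 1)"
    using assms J by (intro powr_mono2) (auto simp: N_def intro: card_mono)
  also have "(\<Sum>i\<in>J. \<bar>a i\<bar> powr p) = (\<Sum>i\<in>I. \<bar>a i\<bar> powr p)"
    using assms J by (intro sum.mono_neutral_left) (auto simp: J_def)
  finally have "(\<Sum>i\<in>J. \<bar>a i\<bar>) powr p \<le> real (card I) powr (p - 1) * (\<Sum>i\<in>I. \<bar>a i\<bar> powr p)"
    by (auto simp: sum_nonneg mult_right_mono)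
  moreover have "(\<Sum>i\<in>I. a i) = (\<Sum>i\<in>J. a i)"
    using assms J by (intro sum.mono_neutral_right) (auto simp: J_def)
  then have "\<bar>\<Sum>i\<in>I. a i\<bar> powr p \<le> (\<Sum>i\<in>J. \<bar>a i\<bar>) powr p"
    using assms by (intro powr_mono2) auto
  ultimately show ?thesis by simp
qed (simp add: sum_nonneg)

text \<open>The \<open>p\<close>-th power of \<open>Lp_norm\<close>. Without the root and the case
  distinction for infinity it is a plain nonnegative integral, to which Tonelli's theorem applies
  directly.\<close>

definition nn_Lp :: "real \<Rightarrow> (real \<Rightarrow> real) \<Rightarrow> ennreal"
  where "nn_Lp p h = (\<integral>\<^sup>+ x. ennreal (\<bar>h x\<bar> powr p) \<partial>lborel)"

text \<open>Takes the place of Minkowski's inequality. Nothing is lost for \<open>N\<close> summands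
  of equal norm, such as translates of one function: the factor becomes
  \<open>N powr (p - 1) * N = N powr p\<close>, as Minkowski would give.\<close>

lemma nn_Lp_sum_le:
  assumes "finite I" "p \<ge> 1" and [measurable]: "\<And>i. i \<in> I \<Longrightarrow> h i \<in> borel_measurable borel"
  shows "nn_Lp p (\<lambda>x. \<Sum>i\<in>I. h i x) \<le> ennreal (real (card I) powr (p - 1)) * (\<Sum>i\<in>I. nn_Lp p (h i))"
proof -
  have "nn_Lp p (\<lambda>x. \<Sum>i\<in>I. h i x)
     \<le> (\<integral>\<^sup>+ x. ennreal (real (card I) powr (p - 1)) * (\<Sum>i\<in>I. ennreal (\<bar>h i x\<bar> powr p)) \<partial>lborel)"
    unfolding nn_Lp_def using power_mean_powr[OF assms(1,2)]
    by (intro nn_integral_mono) (simp add: ennreal_mult[symmetric] sum_nonneg)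
  also have "\<dots> = ennreal (real (card I) powr (p - 1)) * (\<Sum>i\<in>I. nn_Lp p (h i))"
    unfolding nn_Lp_def using assms(3)
    by (subst nn_integral_cmult) (auto simp: sum_nonneg nn_integral_sum simp flip: sum_ennreal)
  finally show ?thesis .
qed

lemma nn_Lp_translate:
  assumes [measurable]: "h \<in> borel_measurable borel"
  shows "nn_Lp p (\<lambda>x. h (x + a)) = nn_Lp p h"
  unfolding nn_Lp_def
  by (subst (2) nn_integral_real_affine[where c = 1 and t = a]) (auto simp: add.commute)

lemma nn_Lp_cmult:
  assumes [measurable]: "h \<in> borel_measurable borel"
  shows "nn_Lp p (\<lambda>x. c * h x) = ennreal (\<bar>c\<bar> powr p) * nn_Lp p h"
  unfolding nn_Lp_def
  by (subst nn_integral_cmult[symmetric]) (auto simp: abs_mult powr_mult ennreal_mult)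

section \<open>Finite differences and dilation of their step\<close>

definition shift_sum :: "nat \<Rightarrow> real \<Rightarrow> (real \<Rightarrow> real) \<Rightarrow> real \<Rightarrow> real"
  where "shift_sum N t h x = (\<Sum>i<N. h (x + real i * t))"

definition diff1 :: "real \<Rightarrow> (real \<Rightarrow> real) \<Rightarrow> real \<Rightarrow> real"
  where "diff1 t h x = h (x + t) - h x"

lemma shift_sum_measurable [measurable]:
  assumes [measurable]: "h \<in> borel_measurable borel"
  shows "shift_sum N t h \<in> borel_measurable borel"
  unfolding shift_sum_def by measurable

lemma diff1_measurable [measurable]:
  assumes [measurable]: "h \<in> borel_measurable borel"
  shows "diff1 t h \<in> borel_measurable borel"
  unfolding diff1_def by measurable

lemma nn_Lp_shift_sum_le:
  assumes [measurable]: "h \<in> borel_measurable borel" and "p \<ge> 1"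
  shows "nn_Lp p (shift_sum N t h) \<le> ennreal (real N powr p) * nn_Lp p h"
proof (cases "N = 0")
  case True
  then show ?thesis by (simp add: nn_Lp_def shift_sum_def)
next
  case False
  have "nn_Lp p (shift_sum N t h) \<le> ennreal (real N powr (p - 1)) * (\<Sum>i<N. nn_Lp p (\<lambda>x. h (x + real i * t)))"
    unfolding shift_sum_def using nn_Lp_sum_le[of "{..<N}" p "\<lambda>i x. h (x + real i * t)"] assms by simp
  also have "\<dots> = ennreal (real N powr (p - 1) * real N) * nn_Lp p h"
    by (simp add: nn_Lp_translate ennreal_mult ennreal_of_nat_eq_real_of_nat mult.assoc)
  finally show ?thesis using False by (simp add: powr_diff)
qed

lemma nn_Lp_diff1_le:
  assumes [measurable]: "h \<in> borel_measurable borel" and "p \<ge> 1"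
  shows "nn_Lp p (diff1 t h) \<le> ennreal (2 powr p) * nn_Lp p h"
proof -
  \<comment> \<open>A sum indexed by the two truth values, so that \<open>nn_Lp_sum_le\<close>
    covers the difference of two functions.\<close>
  define H where "H = (\<lambda>b::bool. if b then (\<lambda>x. h (x + t)) else (\<lambda>x. - h x))"
  have [measurable]: "H b \<in> borel_measurable borel" for b by (simp add: H_def)
  have "nn_Lp p (diff1 t h) = nn_Lp p (\<lambda>x. \<Sum>b\<in>UNIV. H b x)"
    by (simp add: diff1_def[abs_def] H_def UNIV_bool)
  also have "\<dots> \<le> ennreal (2 powr (p - 1)) * (\<Sum>b\<in>UNIV. nn_Lp p (H b))"
    using nn_Lp_sum_le[of UNIV p H] assms by simp
  also have "\<dots> = ennreal (2 powr (p - 1)) * (nn_Lp p h + nn_Lp p h)"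
    by (simp add: H_def UNIV_bool nn_Lp_translate) (simp add: nn_Lp_def)
  also have "\<dots> = ennreal (2 powr (p - 1) * 2) * nn_Lp p h"
    by (simp add: ennreal_mult mult.assoc mult_2)
  finally show ?thesis by (simp add: powr_diff)
qed

lemma nn_Lp_funpow_le:
  assumes "\<And>h. h \<in> borel_measurable borel \<Longrightarrow> F h \<in> borel_measurable borel"
    and "\<And>h. h \<in> borel_measurable borel \<Longrightarrow> nn_Lp p (F h) \<le> ennreal c * nn_Lp p h"
    and "h \<in> borel_measurable borel" "0 \<le> c"
  shows "nn_Lp p ((F ^^ r) h) \<le> ennreal (c ^ r) * nn_Lp p h"
proof -
  have meas: "(F ^^ r) h \<in> borel_measurable borel" for r
    by (induction r) (use assms in auto)
  show ?thesis
  proof (induction r)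
    case (Suc r)
    have "nn_Lp p ((F ^^ Suc r) h) \<le> ennreal c * nn_Lp p ((F ^^ r) h)"
      using assms(2) meas by simp
    also have "\<dots> \<le> ennreal c * (ennreal (c ^ r) * nn_Lp p h)"
      by (intro mult_left_mono Suc) simp
    finally show ?case using assms(4) by (simp add: ennreal_mult mult.assoc)
  qed simp
qed

lemma fwd_diff_Suc: "fwd_diff (Suc r) t h = diff1 t (fwd_diff r t h)"
proof
  fix x
  let ?g = "\<lambda>j. h (x + real j * t)"
  have alt: "fwd_diff r t h x = (\<Sum>j\<le>r. (-1) ^ (r - j) * real (r choose j) * h (x + real j * t))" for r x
    by (simp add: fwd_diff_def atLeast0AtMost)
  have s: "(-1::real) ^ (r - j) = (-1) ^ r * (-1) ^ j" if "j \<le> r" for r j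
    by (metis (no_types, lifting) le_add_diff_inverse2 minus_one_power_iff mult_minus1 power_add that even_add
      mult.right_neutral mult_minus_right minus_minus mult_1)
  \<comment> \<open>Pulling out \<open>(-1) ^ r\<close> leaves the signs \<open>(-1) ^ j\<close>,
    free of the truncated subtraction \<open>r - j\<close>; Pascal's rule can then be applied term
    by term.\<close>
  have alt2: "fwd_diff r t h x = (-1) ^ r * (\<Sum>j\<le>r. (-1) ^ j * real (r choose j) * h (x + real j * t))" for r x
    unfolding alt sum_distrib_left by (intro sum.cong) (simp_all add: s mult.assoc)
  have "(\<Sum>j\<le>Suc r. (-1) ^ j * real (Suc r choose j) * ?g j)
     = ?g 0 + (\<Sum>j\<le>r. (-1) ^ Suc j * real (Suc r choose Suc j) * ?g (Suc j))"
    by (subst sum.atMost_Suc_shift) simp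
  also have "\<dots> = ?g 0 + (\<Sum>j\<le>r. (-1) ^ Suc j * real (r choose Suc j) * ?g (Suc j))
      - (\<Sum>j\<le>r. (-1) ^ j * real (r choose j) * ?g (Suc j))"
  proof -
    have "(\<Sum>j\<le>r. (-1) ^ Suc j * real (Suc r choose Suc j) * ?g (Suc j))
        = (\<Sum>j\<le>r. (-1) ^ Suc j * real (r choose Suc j) * ?g (Suc j))
          - (\<Sum>j\<le>r. (-1) ^ j * real (r choose j) * ?g (Suc j))"
      unfolding sum_subtractf[symmetric] by (intro sum.cong refl) (simp add: algebra_simps)
    then show ?thesis by simp
  qed
  also have "?g 0 + (\<Sum>j\<le>r. (-1) ^ Suc j * real (r choose Suc j) * ?g (Suc j))
    = (\<Sum>j\<le>Suc r. (-1) ^ j * real (r choose j) * ?g j)"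
    by (subst sum.atMost_Suc_shift) simp
  also have "\<dots> = (\<Sum>j\<le>r. (-1) ^ j * real (r choose j) * ?g j)" by simp
  finally have eq: "(\<Sum>j\<le>Suc r. (-1) ^ j * real (Suc r choose j) * ?g j)
    = (\<Sum>j\<le>r. (-1) ^ j * real (r choose j) * ?g j)
      - (\<Sum>j\<le>r. (-1) ^ j * real (r choose j) * ?g (Suc j))" .
  have "fwd_diff r t h (x + t) = (-1) ^ r * (\<Sum>j\<le>r. (-1) ^ j * real (r choose j) * ?g (Suc j))"
    unfolding alt2 by (simp add: algebra_simps)
  then show "fwd_diff (Suc r) t h x = diff1 t (fwd_diff r t h) x"
    unfolding diff1_def alt2[of "Suc r"] alt2[of r x] eq by (simp only: power_Suc) (simp add: right_diff_distrib)
qed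

lemma fwd_diff_funpow: "fwd_diff r t h = (diff1 t ^^ r) h"
  by (induction r) (auto simp: fwd_diff_Suc, auto simp: fwd_diff_def)

text \<open>With \<open>T\<close> the translation by \<open>t\<close>, this is \<open>T\<^sup>N - 1 = (\<Sum>\<^sub>i T\<^sup>i) (T - 1)\<close>.\<close>

lemma diff1_scale: "diff1 (real N * t) h = shift_sum N t (diff1 t h)"
proof
  fix x
  show "diff1 (real N * t) h x = shift_sum N t (diff1 t h) x"
    using sum_lessThan_telescope[of "\<lambda>i. h (x + real i * t)" N]
    by (simp add: diff1_def shift_sum_def algebra_simps)
qed

lemma shift_sum_diff1: "shift_sum N t (diff1 s h) = diff1 s (shift_sum N t h)"
  by (auto simp: shift_sum_def diff1_def fun_eq_iff sum_subtractf add_ac)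

text \<open>The factorisation of \<open>diff1_scale\<close> raised to the power \<open>r\<close>:
  the two factors commute, so all the shift sums gather on the left and an unscaled
  \<open>r\<close>-th difference remains.\<close>

lemma fwd_diff_scale: "fwd_diff r (real N * t) h = (shift_sum N t ^^ r) (fwd_diff r t h)"
proof -
  have comm: "(shift_sum N t ^^ r) (diff1 t h) = diff1 t ((shift_sum N t ^^ r) h)" for r h
    by (induction r) (simp_all add: shift_sum_diff1)
  show ?thesis unfolding fwd_diff_funpow
    by (induction r) (simp_all add: diff1_scale comm)
qed

lemma fwd_diff_measurable [measurable]:
  assumes [measurable]: "h \<in> borel_measurable borel"
  shows "fwd_diff r t h \<in> borel_measurable borel"
  unfolding fwd_diff_def by measurable

lemma nn_Lp_fwd_diff_le:
  assumes "h \<in> borel_measurable borel" "p \<ge> 1"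
  shows "nn_Lp p (fwd_diff r t h) \<le> ennreal ((2 powr p) ^ r) * nn_Lp p h"
  unfolding fwd_diff_funpow
  using nn_Lp_funpow_le[of "diff1 t" p "2 powr p" h r] assms nn_Lp_diff1_le by auto

text \<open>The step is cut into \<open>N\<close> equal parts of size at most \<delta>, and each of
  the \<open>r\<close> shift sums costs a factor \<open>N powr p\<close>. An arbitrary bound
  \<Omega> stands for the modulus, so that only \<open>p\<close>-th powers occur.\<close>

lemma nn_Lp_fwd_diff_scale:
  assumes [measurable]: "h \<in> borel_measurable borel" and p: "p \<ge> 1" and d: "\<delta> > 0"
    and bound: "\<And>t. \<bar>t\<bar> \<le> \<delta> \<Longrightarrow> nn_Lp p (fwd_diff r t h) \<le> \<Omega>"
  shows "nn_Lp p (fwd_diff r t h) \<le> ennreal ((1 + \<bar>t\<bar> / \<delta>) powr (real r * p)) * \<Omega>"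
proof -
  \<comment> \<open>Floor plus one rather than the ceiling keeps \<open>N\<close> positive at
    \<open>t = 0\<close>, and \<open>N\<close> is still at most
    \<open>1 + \<bar>t\<bar> / \<delta>\<close>.\<close>
  define N where "N = nat \<lfloor>\<bar>t\<bar> / \<delta>\<rfloor> + 1"
  have N: "\<bar>t\<bar> / \<delta> \<le> real N" "real N \<le> 1 + \<bar>t\<bar> / \<delta>" "N \<ge> 1"
    unfolding N_def using d by (auto, linarith)
  have le: "\<bar>t / real N\<bar> \<le> \<delta>"
    using N d by (simp add: field_simps)
  have "nn_Lp p (fwd_diff r t h) = nn_Lp p (fwd_diff r (real N * (t / real N)) h)"
    using N by simp
  also have "\<dots> \<le> ennreal ((real N powr p) ^ r) * nn_Lp p (fwd_diff r (t / real N) h)"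
    unfolding fwd_diff_scale
    by (intro nn_Lp_funpow_le) (use p nn_Lp_shift_sum_le in auto)
  also have "\<dots> \<le> ennreal ((1 + \<bar>t\<bar> / \<delta>) powr (real r * p)) * \<Omega>"
  proof (rule mult_mono)
    have "(real N powr p) ^ r = real N powr (real r * p)"
      using N by (simp add: powr_realpow[symmetric] powr_powr mult.commute)
    also have "\<dots> \<le> (1 + \<bar>t\<bar> / \<delta>) powr (real r * p)"
      using N p by (intro powr_mono2) auto
    finally show "ennreal ((real N powr p) ^ r) \<le> ennreal ((1 + \<bar>t\<bar> / \<delta>) powr (real r * p))"
      by (rule ennreal_leI)
  qed (use bound le in auto)
  finally show ?thesis .
qed

section \<open>Moments of the Poisson--Cauchy kernel\<close>

text \<open>The exponent is left free because \<beta>, \<open>\<beta> / 2\<close>,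
  \<open>p * \<beta> / 2\<close> and \<open>q * \<beta> / 2\<close> all occur.\<close>

definition kern :: "nat \<Rightarrow> real \<Rightarrow> real \<Rightarrow> real"
  where "kern \<alpha> b u = 1 / (u ^ (2 * \<alpha>) + 1) powr b"

text \<open>The value of the integral of \<open>\<bar>u\<bar> powr c * kern \<alpha> b u\<close>
  over the whole line, which is a Beta value divided by \<alpha>.\<close>

definition kern_moment :: "nat \<Rightarrow> real \<Rightarrow> real \<Rightarrow> real"
  where "kern_moment \<alpha> b c = Gamma ((c + 1) / (2 * real \<alpha>)) * Gamma (b - (c + 1) / (2 * real \<alpha>))
    / (real \<alpha> * Gamma b)"

lemma kern_pos: "kern \<alpha> b u > 0"
proof -
  have "u ^ (2 * \<alpha>) + 1 > 0" by (intro add_nonneg_pos) auto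
  then show ?thesis by (simp add: kern_def)
qed

lemma kern_nonneg [simp]: "0 \<le> kern \<alpha> b u"
  using kern_pos[of \<alpha> b u] by simp

lemma kern_abs: "kern \<alpha> b \<bar>u\<bar> = kern \<alpha> b u"
  by (simp add: kern_def power_even_abs)

lemma kern_minus: "kern \<alpha> b (- u) = kern \<alpha> b u"
  using kern_abs[of \<alpha> b "- u"] kern_abs[of \<alpha> b u] by simp

lemma kern_measurable [measurable]: "kern \<alpha> b \<in> borel_measurable borel"
  unfolding kern_def by measurable

lemma kern_powr: "kern \<alpha> b u powr s = kern \<alpha> (s * b) u"
  by (simp add: kern_def powr_divide powr_powr mult.commute)

lemma kern_mult: "kern \<alpha> b u * kern \<alpha> c u = kern \<alpha> (b + c) u"
  by (simp add: kern_def powr_add)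

text \<open>The substitution \<open>t = u ^ m / (u ^ m + 1)\<close> with
  \<open>m = 2 * \<alpha>\<close> carries the half line onto the unit interval and turns the
  integral into a multiple of Euler's Beta integral. A single change of variables delivers both
  integrability and the value.\<close>

lemma kern_half_line:
  fixes c b :: real
  assumes \<alpha>: "\<alpha> \<ge> 1" and c: "c > -1" and b: "(c + 1) / (2 * real \<alpha>) < b"
  shows "set_integrable lborel {0<..} (\<lambda>u. u powr c * kern \<alpha> b u)"
    and "(LBINT u:{0<..}. u powr c * kern \<alpha> b u) = kern_moment \<alpha> b c / 2"
proof -
  define m where "m = 2 * \<alpha>"
  have m: "m \<ge> 1" "real m > 0" using \<alpha> by (auto simp: m_def)
  define a where "a = (c + 1) / real m"
  define B where "B = b - a"
  have a: "a > 0" using c m by (simp add: a_def)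
  have B: "B > 0" using b by (simp add: B_def a_def m_def)
  define f where "f = (\<lambda>t::real. t powr (a - 1) * (1 - t) powr (B - 1))"
  define g where "g = (\<lambda>u::real. u ^ m / (u ^ m + 1))"
  define g' where "g' = (\<lambda>u::real. real m * u ^ (m - 1) / (u ^ m + 1)\<^sup>2)"
  have der: "(g has_field_derivative g' u) (at u within {0<..})" if "u \<in> {0<..}" for u
  proof -
    have "u ^ m + 1 \<noteq> 0" using that by (simp add: add_pos_pos less_imp_neq[symmetric])
    then show ?thesis unfolding g_def g'_def
      by (auto intro!: derivative_eq_intros simp: field_simps power2_eq_square)
  qed
  have one_minus: "1 - g u = 1 / (u ^ m + 1)" if "u > 0" for u
  proof -
    have "u ^ m + 1 \<noteq> 0" using that by (simp add: add_pos_pos less_imp_neq[symmetric])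
    then show ?thesis by (simp add: g_def field_simps)
  qed
  have inj: "inj_on g {0<..}"
  proof (rule inj_onI)
    fix x y :: real assume xy: "x \<in> {0<..}" "y \<in> {0<..}" "g x = g y"
    then have "1 / (x ^ m + 1) = 1 / (y ^ m + 1)" using one_minus by (metis greaterThan_iff)
    then have "x ^ m = y ^ m" by simp
    then show "x = y" using xy m by (auto simp: power_eq_iff_eq_base)
  qed
  have img: "g ` {0<..} = {0<..<1}"
  proof (intro equalityI subsetI)
    fix t assume "t \<in> g ` {0<..}"
    then obtain u where u: "u > 0" "t = g u" by auto
    have "u ^ m > 0" using u by simp
    then have "0 < u ^ m / (u ^ m + 1)" "u ^ m / (u ^ m + 1) < 1" by (auto simp: divide_less_eq)
    then show "t \<in> {0<..<1}" using u by (simp add: g_def)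
  next
    fix t :: real assume t: "t \<in> {0<..<1}"
    define u where "u = (t / (1 - t)) powr (1 / real m)"
    have u: "u > 0" using t by (simp add: u_def)
    have "u ^ m = t / (1 - t)"
      using u t m by (subst powr_realpow[symmetric]) (auto simp: u_def powr_powr)
    moreover have "t / (1 - t) + 1 = 1 / (1 - t)" using t by (simp add: field_simps)
    ultimately have "g u = t" using t by (simp add: g_def)
    then show "t \<in> g ` {0<..}" using u by auto
  qed
  have hi: "(f has_integral Beta a B) {0<..<1}"
    using has_integral_Beta_real[OF a B] by (simp add: f_def has_integral_Icc_iff_Ioo)
  have "f absolutely_integrable_on {0<..<1}"
    by (rule nonnegative_absolutely_integrable_1[OF has_integral_integrable[OF hi]]) (simp add: f_def)
  moreover have "integral {0<..<1} f = Beta a B"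
    using hi by (rule integral_unique)
  moreover have "(\<lambda>x. \<bar>g' x\<bar> * f (g x)) absolutely_integrable_on {0<..}
      \<and> integral {0<..} (\<lambda>x. \<bar>g' x\<bar> * f (g x)) = Beta a B
    \<longleftrightarrow> f absolutely_integrable_on g ` {0<..} \<and> integral (g ` {0<..}) f = Beta a B"
    by (rule has_absolute_integral_change_of_variables_1'[OF _ der inj]) auto
  ultimately have ai: "(\<lambda>x. \<bar>g' x\<bar> * f (g x)) absolutely_integrable_on {0<..}"
    and ii: "integral {0<..} (\<lambda>x. \<bar>g' x\<bar> * f (g x)) = Beta a B"
    unfolding img by blast+
  \<comment> \<open>With \<open>k = u ^ m + 1\<close>, the Beta integrand contributes
    \<open>k powr (2 - b)\<close> and the derivative of the substitution contributes
    \<open>1 / k\<^sup>2\<close>, so that exactly the kernel \<open>1 / k powr b\<close> is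
    left.\<close>
  have eq: "\<bar>g' u\<bar> * f (g u) = real m * (u powr c * kern \<alpha> b u)" if u: "u > 0" for u
  proof -
    define k where "k = u ^ m + 1"
    have k: "k > 0" using u by (simp add: k_def add_pos_pos)
    have um: "u ^ m = u powr real m" "u ^ (m - 1) = u powr (real m - 1)"
      using u m powr_realpow[of u m] powr_realpow[of u "m - 1"] by (simp_all add: of_nat_diff)
    have "f (g u) = (u powr real m / k) powr (a - 1) * (1 / k) powr (B - 1)"
      unfolding f_def one_minus[OF u] using um by (simp add: g_def k_def)
    also have "\<dots> = u powr (real m * (a - 1)) / (k powr (a - 1) * k powr (B - 1))"
      using u k by (simp add: powr_divide powr_powr)
    also have "k powr (a - 1) * k powr (B - 1) = k powr (b - 2)"
      using k by (simp add: powr_add[symmetric] B_def)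
    also have "k powr (b - 2) = k powr b / k\<^sup>2"
      using k by (simp add: powr_diff)
    finally have f: "f (g u) = u powr (real m * (a - 1)) * k\<^sup>2 / k powr b" by simp
    have "\<bar>g' u\<bar> = real m * u powr (real m - 1) / k\<^sup>2"
      using u um by (simp add: g'_def k_def)
    then have "\<bar>g' u\<bar> * f (g u) = real m * (u powr (real m - 1) * u powr (real m * (a - 1))) / k powr b"
      using k f by simp
    also have "u powr (real m - 1) * u powr (real m * (a - 1)) = u powr c"
      using m u by (simp add: powr_add[symmetric] a_def field_simps)
    finally show ?thesis by (simp add: kern_def k_def m_def)
  qed
  let ?h = "\<lambda>u. u powr c * kern \<alpha> b u"
  have ai2: "(\<lambda>u. real m * ?h u) absolutely_integrable_on {0<..}"
    by (rule set_integrable_cong[THEN iffD1, OF refl refl _ ai]) (use eq in simp)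
  have "(\<lambda>u. (1 / real m) * (real m * ?h u)) absolutely_integrable_on {0<..}"
    by (rule set_integrable_mult_right) (use ai2 in simp)
  then have ai3: "?h absolutely_integrable_on {0<..}" using m by simp
  \<comment> \<open>The change of variables concerns the completed Lebesgue measure; Borel
    measurability of the integrand brings the result back to \<open>lborel\<close>.\<close>
  then show si: "set_integrable lborel {0<..} ?h"
    unfolding set_integrable_def
    by (subst (asm) integrable_completion) auto
  have "integral {0<..} (\<lambda>u. real m * ?h u) = Beta a B"
    unfolding ii[symmetric] by (rule integral_cong) (use eq in auto)
  then have "real m * integral {0<..} ?h = Beta a B" by simp
  moreover have "(LBINT u:{0<..}. ?h u) = integral {0<..} ?h"
    using si by (rule set_borel_integral_eq_integral(2))
  ultimately have "(LBINT u:{0<..}. ?h u) = Beta a B / real m"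
    using m by (simp add: eq_divide_eq mult.commute)
  moreover have "Beta a B = Gamma a * Gamma B / Gamma b"
    by (simp add: Beta_def B_def)
  ultimately show "(LBINT u:{0<..}. ?h u) = kern_moment \<alpha> b c / 2"
    by (simp add: kern_moment_def a_def B_def m_def mult_ac)
qed

lemma nn_integral_abs:
  fixes H :: "real \<Rightarrow> ennreal"
  assumes [measurable]: "H \<in> borel_measurable borel"
  shows "(\<integral>\<^sup>+ u. H \<bar>u\<bar> \<partial>lborel) = 2 * (\<integral>\<^sup>+ u. H u * indicator {0<..} u \<partial>lborel)"
proof -
  have "AE u in lborel. u \<noteq> (0::real)" by (rule AE_lborel_singleton)
  then have "(\<integral>\<^sup>+ u. H \<bar>u\<bar> \<partial>lborel)
      = (\<integral>\<^sup>+ u. H u * indicator {0<..} u + H (- u) * indicator {0<..} (- u) \<partial>lborel)"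
    by (intro nn_integral_cong_AE) (auto elim!: eventually_mono split: split_indicator)
  also have "\<dots> = (\<integral>\<^sup>+ u. H u * indicator {0<..} u \<partial>lborel) + (\<integral>\<^sup>+ u. H (- u) * indicator {0<..} (- u) \<partial>lborel)"
    by (rule nn_integral_add) auto
  also have "(\<integral>\<^sup>+ u. H (- u) * indicator {0<..} (- u) \<partial>lborel) = (\<integral>\<^sup>+ u. H u * indicator {0<..} u \<partial>lborel)"
    by (subst (2) nn_integral_real_affine[where c = "-1" and t = 0]) auto
  finally show ?thesis by (simp add: mult_2)
qed

lemma nn_integral_abs_eq:
  fixes h :: "real \<Rightarrow> real"
  assumes [measurable]: "h \<in> borel_measurable borel" and nn: "\<And>u. u > 0 \<Longrightarrow> 0 \<le> h u"
    and int: "set_integrable lborel {0<..} h"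
  shows "(\<integral>\<^sup>+ u. ennreal (h \<bar>u\<bar>) \<partial>lborel) = ennreal (2 * (LBINT u:{0<..}. h u))"
proof -
  have "(\<integral>\<^sup>+ u. ennreal (h u) * indicator {0<..} u \<partial>lborel) = (\<integral>\<^sup>+ u. ennreal (indicator {0<..} u *\<^sub>R h u) \<partial>lborel)"
    by (intro nn_integral_cong) (auto split: split_indicator)
  also have "\<dots> = ennreal (LBINT u:{0<..}. h u)"
    unfolding set_lebesgue_integral_def using int nn
    by (intro nn_integral_eq_integral) (auto simp: set_integrable_def split: split_indicator)
  finally have "(\<integral>\<^sup>+ u. ennreal (h u) * indicator {0<..} u \<partial>lborel) = ennreal (LBINT u:{0<..}. h u)" .
  moreover have "0 \<le> (LBINT u:{0<..}. h u)"
    unfolding set_lebesgue_integral_def using nn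
    by (intro integral_nonneg_AE) (auto split: split_indicator)
  ultimately show ?thesis
    using nn_integral_abs[of "\<lambda>u. ennreal (h u)"] by (simp add: ennreal_mult)
qed

lemma kern_moment_pos:
  assumes "\<alpha> \<ge> 1" "c > -1" "(c + 1) / (2 * real \<alpha>) < b"
  shows "0 < kern_moment \<alpha> b c"
proof -
  have "0 < (c + 1) / (2 * real \<alpha>)" using assms by simp
  moreover have "0 < b" using calculation assms by linarith
  ultimately show ?thesis
    unfolding kern_moment_def using assms by (intro divide_pos_pos mult_pos_pos Gamma_real_pos) auto
qed

lemma nn_integral_kern:
  assumes "\<alpha> \<ge> 1" "c > -1" "(c + 1) / (2 * real \<alpha>) < b"
  shows "(\<integral>\<^sup>+ u. ennreal (\<bar>u\<bar> powr c * kern \<alpha> b u) \<partial>lborel) = ennreal (kern_moment \<alpha> b c)"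
  using nn_integral_abs_eq[of "\<lambda>u. u powr c * kern \<alpha> b u"] kern_half_line[OF assms]
  by (simp add: kern_abs)

lemma
  assumes \<alpha>: "\<alpha> \<ge> 1" and k: "(real k + 1) / (2 * real \<alpha>) < b"
  shows integrable_power_kern: "integrable lborel (\<lambda>u. u ^ k * kern \<alpha> b u)"
    and integral_power_kern_even: "even k \<Longrightarrow> (LINT u|lborel. u ^ k * kern \<alpha> b u) = kern_moment \<alpha> b (real k)"
    and integral_power_kern_odd: "odd k \<Longrightarrow> (LINT u|lborel. u ^ k * kern \<alpha> b u) = 0"
proof -
  \<comment> \<open>Zero is excluded because for \<open>k = 0\<close> the two integrands differ
    there: \<open>0 ^ 0 = 1\<close> but \<open>0 powr 0 = 0\<close>.\<close>
  have "AE u in lborel. u \<noteq> (0::real)" by (rule AE_lborel_singleton)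
  then have "(\<integral>\<^sup>+ u. ennreal (norm (u ^ k * kern \<alpha> b u)) \<partial>lborel)
      = (\<integral>\<^sup>+ u. ennreal (\<bar>u\<bar> powr real k * kern \<alpha> b u) \<partial>lborel)"
    by (intro nn_integral_cong_AE)
      (auto elim!: eventually_mono simp: abs_mult power_abs powr_realpow abs_of_nonneg)
  also have "\<dots> = ennreal (kern_moment \<alpha> b (real k))"
    using assms by (intro nn_integral_kern) auto
  finally have nn: "(\<integral>\<^sup>+ u. ennreal (norm (u ^ k * kern \<alpha> b u)) \<partial>lborel) = ennreal (kern_moment \<alpha> b (real k))" .
  then show "integrable lborel (\<lambda>u. u ^ k * kern \<alpha> b u)"
    by (intro integrableI_bounded) auto
  show "(LINT u|lborel. u ^ k * kern \<alpha> b u) = kern_moment \<alpha> b (real k)" if "even k"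
  proof (rule integral_eq_nn_integral[THEN trans])
    show "AE u in lborel. 0 \<le> u ^ k * kern \<alpha> b u" using that by (simp add: zero_le_even_power)
    have "0 < kern_moment \<alpha> b (real k)" using assms by (intro kern_moment_pos) auto
    then show "enn2real (\<integral>\<^sup>+ u. ennreal (u ^ k * kern \<alpha> b u) \<partial>lborel) = kern_moment \<alpha> b (real k)"
      using nn that by (simp add: abs_of_nonneg zero_le_even_power)
  qed auto
  show "(LINT u|lborel. u ^ k * kern \<alpha> b u) = 0" if "odd k"
  proof -
    \<comment> \<open>The reflection \<open>u \<mapsto> - u\<close> preserves the even kernel and
      changes the sign of the odd power.\<close>
    have "(LINT u|lborel. u ^ k * kern \<alpha> b u) = (LINT u|lborel. - (u ^ k * kern \<alpha> b u))"
      using that by (subst lborel_integral_real_affine[where c = "-1" and t = 0]) (auto simp: kern_minus)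
    then show ?thesis by simp
  qed
qed

lemma tau_int2_eq: "tau_int2 n \<alpha> \<beta> p u = u powr (real n * p - 1) * kern \<alpha> (p * \<beta> / 2) u"
  by (simp add: tau_int2_def kern_def)

lemma tau_int1_eq: "tau_int1 r n \<alpha> \<beta> p u = (1 + u) powr (real r * p + 1) * tau_int2 n \<alpha> \<beta> p u"
  by (simp add: tau_int1_def tau_int2_def)

section \<open>Finiteness and positivity of the constant \<tau>\<close>

locale tau_params =
  fixes r n \<alpha> :: nat and p \<beta> :: real
  assumes r: "r \<ge> 1" and n: "n \<ge> 1" and \<alpha>: "\<alpha> \<ge> 1" and p: "p > 1"
    and \<beta>: "\<beta> > (1 / real \<alpha>) * (1 / p + real n + real r)"
begin

text \<open>The hypothesis on \<beta> cleared of denominators. It is precisely the convergence at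
  infinity of the first integral of \<tau>: growth of order \<open>n p + r p\<close> against decay
  of order \<open>\<alpha> p \<beta>\<close>, with a margin above 1.\<close>

lemma \<beta>_bound: "1 + real n * p + real r * p < real \<alpha> * p * \<beta>"
proof -
  have "(1 / real \<alpha>) * (1 / p + real n + real r) * (real \<alpha> * p) < \<beta> * (real \<alpha> * p)"
    using \<beta> \<alpha> p by (intro mult_strict_right_mono) auto
  moreover have "(1 / real \<alpha>) * (1 / p + real n + real r) * (real \<alpha> * p) = 1 + real n * p + real r * p"
    using \<alpha> p by (simp add: field_simps)
  ultimately show ?thesis by (simp add: mult_ac)
qed

lemma np_pos: "real n * p > 1"
proof -
  have "1 * p \<le> real n * p" using n p by (intro mult_right_mono) auto
  then show ?thesis using p by linarith
qed

lemma tau_int2_integrable: "set_integrable lborel {0<..} (tau_int2 n \<alpha> \<beta> p)"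
proof -
  have "(real n * p - 1 + 1) / (2 * real \<alpha>) < p * \<beta> / 2"
  proof -
    have "0 \<le> real r * p" using p by simp
    then have "real n * p < real \<alpha> * p * \<beta>" using \<beta>_bound by linarith
    then show ?thesis using \<alpha> by (simp add: field_simps)
  qed
  then show ?thesis
    using kern_half_line(1)[of \<alpha> "real n * p - 1" "p * \<beta> / 2"] np_pos \<alpha>
    by (simp add: tau_int2_eq[abs_def])
qed

lemma tau_int1_integrable: "set_integrable lborel {0<..} (tau_int1 r n \<alpha> \<beta> p)"
proof -
  define c where "c = real r * p + 1"
  have c: "c > 1" using r p by (simp add: c_def)
  have "(real n * p + real r * p + 1) / (2 * real \<alpha>) < p * \<beta> / 2"
    using \<beta>_bound \<alpha> p by (simp add: field_simps)
  then have i1: "set_integrable lborel {0<..} (\<lambda>u. u powr (real n * p + real r * p) * kern \<alpha> (p * \<beta> / 2) u)"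
    using kern_half_line(1)[of \<alpha> "real n * p + real r * p" "p * \<beta> / 2"] np_pos \<alpha> p
    by (auto simp: add_nonneg_nonneg less_le_trans[of "-1" 0])
  have i2: "set_integrable lborel {0<..}
     (\<lambda>u. 2 powr c * (tau_int2 n \<alpha> \<beta> p u + u powr (real n * p + real r * p) * kern \<alpha> (p * \<beta> / 2) u))"
    using tau_int2_integrable i1 by (intro set_integrable_mult_right set_integral_add)
  have m1: "tau_int1 r n \<alpha> \<beta> p \<in> borel_measurable borel"
    unfolding tau_int1_def by measurable
  show ?thesis
  proof (rule set_integrable_bound[OF i2])
    show "set_borel_measurable lborel {0<..} (tau_int1 r n \<alpha> \<beta> p)"
      using m1 unfolding set_borel_measurable_def by measurable
    show "AE u in lborel. u \<in> {0<..} \<longrightarrow> norm (tau_int1 r n \<alpha> \<beta> p u)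
       \<le> norm (2 powr c * (tau_int2 n \<alpha> \<beta> p u + u powr (real n * p + real r * p) * kern \<alpha> (p * \<beta> / 2) u))"
    proof (intro AE_I2 impI)
      fix u :: real assume "u \<in> {0<..}"
      then have u: "u > 0" by simp
      \<comment> \<open>Bounding \<open>1 + u\<close> by \<open>2 * max 1 u\<close> splits the
        binomial factor into a constant and a pure power, so that two kernel moments, of orders
        \<open>n p - 1\<close> and \<open>n p + r p\<close>, dominate the integrand.\<close>
      have "(1 + u) powr c \<le> (2 * max 1 u) powr c"
        using u c by (intro powr_mono2) auto
      also have "\<dots> \<le> 2 powr c * (1 + u powr c)"
        using u c by (cases "u \<le> 1") (auto simp: max_def powr_mult)
      finally have le: "(1 + u) powr c \<le> 2 powr c * (1 + u powr c)" .
      have nn: "0 \<le> tau_int2 n \<alpha> \<beta> p u" by (simp add: tau_int2_eq)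
      have "u powr c * tau_int2 n \<alpha> \<beta> p u = u powr (real n * p + real r * p) * kern \<alpha> (p * \<beta> / 2) u"
        using u by (simp add: tau_int2_eq c_def mult.assoc[symmetric] powr_add[symmetric] add_ac)
      then have "tau_int1 r n \<alpha> \<beta> p u
        \<le> 2 powr c * (tau_int2 n \<alpha> \<beta> p u + u powr (real n * p + real r * p) * kern \<alpha> (p * \<beta> / 2) u)"
        using mult_right_mono[OF le nn] unfolding tau_int1_eq c_def[symmetric]
        by (simp only: distrib_left distrib_right mult.assoc mult_1_right)
      moreover have "0 \<le> tau_int1 r n \<alpha> \<beta> p u" using nn by (simp add: tau_int1_eq)
      ultimately show "norm (tau_int1 r n \<alpha> \<beta> p u)
       \<le> norm (2 powr c * (tau_int2 n \<alpha> \<beta> p u + u powr (real n * p + real r * p) * kern \<alpha> (p * \<beta> / 2) u))"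
        by simp
    qed
  qed
qed

lemma tau_int_less: "u > 0 \<Longrightarrow> tau_int2 n \<alpha> \<beta> p u < tau_int1 r n \<alpha> \<beta> p u"
proof -
  assume u: "u > 0"
  have "1 < (1 + u) powr (real r * p + 1)"
    using u r p by (intro gr_one_powr) (auto intro: add_nonneg_pos)
  moreover have "0 < tau_int2 n \<alpha> \<beta> p u" using u by (simp add: tau_int2_eq kern_pos)
  ultimately show ?thesis by (simp add: tau_int1_eq)
qed

lemma tau_const_eq:
  "tau_const r n \<alpha> \<beta> p = (LBINT u:{0<..}. tau_int1 r n \<alpha> \<beta> p u - tau_int2 n \<alpha> \<beta> p u)"
  unfolding tau_const_def using tau_int1_integrable tau_int2_integrable by (rule set_integral_diff(2)[symmetric])

lemma tau_diff_integrable: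
  "set_integrable lborel {0<..} (\<lambda>u. tau_int1 r n \<alpha> \<beta> p u - tau_int2 n \<alpha> \<beta> p u)"
  using tau_int1_integrable tau_int2_integrable by (rule set_integral_diff(1))

text \<open>The difference of the two integrands is strictly positive on the half line, so a
  vanishing integral would make every part of the half line a null set, the unit interval
  included.\<close>

lemma tau_const_pos: "0 < tau_const r n \<alpha> \<beta> p"
proof -
  let ?h = "\<lambda>u. indicator {0<..} u *\<^sub>R (tau_int1 r n \<alpha> \<beta> p u - tau_int2 n \<alpha> \<beta> p u)"
  have int: "integrable lborel ?h" using tau_diff_integrable by (simp add: set_integrable_def)
  have nn: "0 \<le> ?h u" for u using tau_int_less[of u] by (auto split: split_indicator)
  have "0 \<le> tau_const r n \<alpha> \<beta> p"
    unfolding tau_const_eq set_lebesgue_integral_def using nn by (intro integral_nonneg_AE) auto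
  moreover have "tau_const r n \<alpha> \<beta> p \<noteq> 0"
  proof
    assume "tau_const r n \<alpha> \<beta> p = 0"
    then have "AE u in lborel. ?h u = 0"
      using integral_nonneg_eq_0_iff_AE[OF int] nn by (auto simp: tau_const_eq set_lebesgue_integral_def)
    then have "AE u in lborel. u \<notin> {0<..<(1::real)}"
    proof eventually_elim
      case (elim u)
      then show ?case using tau_int_less[of u] by (auto split: split_indicator_asm)
    qed
    then have "emeasure lborel {0<..<(1::real)} = 0"
      by (subst (asm) AE_iff_measurable[of "{0<..<1}"]) auto
    then show False by simp
  qed
  ultimately show ?thesis by simp
qed

text \<open>The left side is the integral over \<open>u\<close> as the remainder estimate produces
  it; the factor 2 accounts for the two half lines.\<close>

lemma nn_integral_tau:
  "(\<integral>\<^sup>+ u. ennreal (\<bar>u\<bar> powr (real n * p - 1) * ((1 + \<bar>u\<bar>) powr (real r * p + 1) - 1) * kern \<alpha> (p * \<beta> / 2) u) \<partial>lborel)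
    = ennreal (2 * tau_const r n \<alpha> \<beta> p)"
proof -
  have [measurable]: "tau_int1 r n \<alpha> \<beta> p \<in> borel_measurable borel" "tau_int2 n \<alpha> \<beta> p \<in> borel_measurable borel"
    unfolding tau_int1_def tau_int2_def by measurable
  have "\<bar>u\<bar> powr (real n * p - 1) * ((1 + \<bar>u\<bar>) powr (real r * p + 1) - 1) * kern \<alpha> (p * \<beta> / 2) u
    = tau_int1 r n \<alpha> \<beta> p (\<bar>u\<bar>) - tau_int2 n \<alpha> \<beta> p (\<bar>u\<bar>)" for u
    by (simp add: tau_int1_eq tau_int2_eq kern_abs algebra_simps)
  then show ?thesis
    using nn_integral_abs_eq[of "\<lambda>u. tau_int1 r n \<alpha> \<beta> p u - tau_int2 n \<alpha> \<beta> p u"]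
      tau_diff_integrable tau_int_less by (simp add: tau_const_eq less_imp_le)
qed

end

section \<open>The Taylor remainder\<close>

lemma Lp_norm_leI:
  assumes "nn_Lp p h \<le> ennreal (B powr p)" "p > 0" "B \<ge> 0"
  shows "Lp_norm p h \<le> ennreal B"
proof -
  have fin: "nn_Lp p h \<noteq> \<infinity>" using assms(1) by (auto simp: top_unique)
  have "enn2real (nn_Lp p h) \<le> B powr p"
    using assms(1) by (intro enn2real_leI) auto
  then have "enn2real (nn_Lp p h) powr (1 / p) \<le> (B powr p) powr (1 / p)"
    using assms by (intro powr_mono2) auto
  also have "\<dots> = B" using assms by (simp add: powr_powr)
  finally show ?thesis
    using fin by (simp add: Lp_norm_def nn_Lp_def[symmetric] Let_def ennreal_leI)
qed

lemma nn_Lp_leI: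
  assumes "Lp_norm p h \<le> ennreal B" "p > 0" "B \<ge> 0"
  shows "nn_Lp p h \<le> ennreal (B powr p)"
proof -
  have fin: "nn_Lp p h \<noteq> \<infinity>"
    using assms(1) by (auto simp: Lp_norm_def nn_Lp_def[symmetric] Let_def top_unique)
  then have "enn2real (nn_Lp p h) powr (1 / p) \<le> B"
    using assms by (simp add: Lp_norm_def nn_Lp_def[symmetric] Let_def)
  then have "(enn2real (nn_Lp p h) powr (1 / p)) powr p \<le> B powr p"
    using assms by (intro powr_mono2) auto
  then have "enn2real (nn_Lp p h) \<le> B powr p"
    using assms by (simp add: powr_powr)
  then have "ennreal (enn2real (nn_Lp p h)) \<le> ennreal (B powr p)"
    by (rule ennreal_leI)
  then show ?thesis using fin by (simp add: less_top[symmetric] ennreal_enn2real_if)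
qed

lemma in_Lp_nn_Lp_finite:
  assumes "in_Lp p h"
  obtains G where "0 \<le> G" "nn_Lp p h = ennreal G"
proof -
  have "nn_Lp p h \<noteq> \<infinity>"
    using assms by (auto simp: in_Lp_def Lp_norm_def nn_Lp_def[symmetric] Let_def)
  then show ?thesis using that by (cases "nn_Lp p h") auto
qed

text \<open>The operator norm of an \<open>r\<close>-th difference is at most \<open>2 ^ r\<close>
  whatever the step. The uniform bound makes the modulus finite, so that \<open>enn2real\<close>
  loses nothing, and it replaces the modulus in the limits, where \<open>\<xi> ^ n\<close> already
  tends to 0.\<close>

lemma omega_mod_bounded:
  assumes h: "in_Lp p h" and p: "p > 1"
  obtains K where "0 \<le> K" "\<And>\<xi>. omega_mod r p h \<xi> \<le> ennreal K"
proof -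
  obtain G where G: "0 \<le> G" "nn_Lp p h = ennreal G" using in_Lp_nn_Lp_finite[OF h] .
  have [measurable]: "h \<in> borel_measurable borel" using h by (simp add: in_Lp_def)
  define K where "K = ((2 powr p) ^ r * G) powr (1 / p)"
  have "Lp_norm p (fwd_diff r t h) \<le> ennreal K" for t
  proof (rule Lp_norm_leI)
    have "nn_Lp p (fwd_diff r t h) \<le> ennreal ((2 powr p) ^ r * G)"
      using nn_Lp_fwd_diff_le[of h p r t] p G by (simp add: ennreal_mult)
    then show "nn_Lp p (fwd_diff r t h) \<le> ennreal (K powr p)"
      using p G by (simp add: K_def powr_powr)
  qed (use p in \<open>auto simp: K_def\<close>)
  then have "omega_mod r p h \<xi> \<le> ennreal K" for \<xi>
    unfolding omega_mod_def by (intro SUP_least)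
  moreover have "0 \<le> K" by (simp add: K_def)
  ultimately show ?thesis using that by blast
qed

lemma Lp_norm_tendsto_0:
  fixes b :: "real \<Rightarrow> real"
  assumes b: "(b \<longlongrightarrow> 0) (at_right 0)"
    and le: "\<And>\<xi>. \<xi> > 0 \<Longrightarrow> Lp_norm p (H \<xi>) \<le> ennreal (b \<xi>)"
  shows "((\<lambda>\<xi>. Lp_norm p (H \<xi>)) \<longlongrightarrow> 0) (at_right 0)"
proof (rule tendsto_sandwich[where f = "\<lambda>_. 0" and h = "\<lambda>\<xi>. ennreal (b \<xi>)"])
  show "((\<lambda>\<xi>. ennreal (b \<xi>)) \<longlongrightarrow> 0) (at_right 0)"
    using tendsto_ennrealI[OF b] by simp
  show "\<forall>\<^sub>F \<xi> in at_right 0. Lp_norm p (H \<xi>) \<le> ennreal (b \<xi>)"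
    using eventually_at_right_less[of "0::real"] by eventually_elim (rule le)
  show "\<forall>\<^sub>F \<xi> in at_right (0::real). 0 \<le> Lp_norm p (H \<xi>)" by simp
qed (rule tendsto_const)

lemma sum_even_indices:
  fixes G :: "nat \<Rightarrow> 'a :: comm_monoid_add"
  assumes "\<And>k. odd k \<Longrightarrow> G k = 0"
  shows "(\<Sum>k=1..n. G k) = (\<Sum>m=1..n div 2. G (2 * m))"
proof -
  have "(\<Sum>m=1..n div 2. G (2 * m)) = (\<Sum>k\<in>(\<lambda>m. 2 * m) ` {1..n div 2}. G k)"
    by (subst sum.reindex) (auto simp: inj_on_def)
  also have "\<dots> = (\<Sum>k=1..n. G k)"
  proof (rule sum.mono_neutral_left)
    show "\<forall>k\<in>{1..n} - (\<lambda>m. 2 * m) ` {1..n div 2}. G k = 0"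
    proof
      fix k assume k: "k \<in> {1..n} - (\<lambda>m. 2 * m) ` {1..n div 2}"
      have "odd k"
      proof
        assume "even k"
        then obtain m where "k = 2 * m" by (elim evenE)
        then have "k \<in> (\<lambda>m. 2 * m) ` {1..n div 2}" using k by (intro image_eqI[of _ _ m]) auto
        then show False using k by simp
      qed
      then show "G k = 0" by (rule assms)
    qed
  qed auto
  finally show ?thesis by simp
qed

text \<open>Serves the \<open>j = 0\<close> summand of the difference, which comes from no Taylor
  expansion: there the constant \<open>g x\<close> is integrated against the weight, giving a term
  of order \<open>n\<close>.\<close>

lemma has_integral_weight:
  assumes "n \<ge> 1"
  shows "((\<lambda>s::real. (1 - s) ^ (n - 1) / fact (n - 1)) has_integral 1 / fact n) {0..1}"
proof -
  have "((\<lambda>s::real. (1 - s) ^ (n - 1) / fact (n - 1)) has_integral (- ((1 - 1) ^ n / fact n)) - (- ((1 - 0) ^ n / fact n))) {0..1}"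
  proof (rule fundamental_theorem_of_calculus)
    fix s :: real
    have "real n / fact n = 1 / fact (n - 1)"
      using assms by (simp add: fact_reduce)
    then have "real n * (1 - s) ^ (n - 1) / fact n = (1 - s) ^ (n - 1) / fact (n - 1)"
      by (metis mult.commute times_divide_eq_left times_divide_eq_right mult_1)
    then show "((\<lambda>s. - ((1 - s) ^ n / fact n)) has_vector_derivative (1 - s) ^ (n - 1) / fact (n - 1)) (at s within {0..1})"
      unfolding has_real_derivative_iff_has_vector_derivative[symmetric]
      by (auto intro!: derivative_eq_intros)
  qed simp
  then show ?thesis using assms by (simp add: power_0_left)
qed

lemma nn_integral_weight_powr:
  fixes q :: real
  assumes q: "q > 0" and n: "n \<ge> 1"
  shows "(\<integral>\<^sup>+ s. ennreal ((indicator {0..1} s * (1 - s) ^ (n - 1)) powr q) \<partial>lborel)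
    = ennreal (1 / (q * (real n - 1) + 1))"
proof -
  define e where "e = q * (real n - 1)"
  have e: "e \<ge> 0" using q n by (simp add: e_def)
  define w where "w = (\<lambda>s::real. (indicator {0..1} s * (1 - s) ^ (n - 1)) powr q)"
  have "(\<integral>\<^sup>+ s. ennreal (w s) \<partial>lborel) = (\<integral>\<^sup>+ s. ennreal (w (1 - s)) \<partial>lborel)"
    by (subst nn_integral_real_affine[where c = "-1" and t = 1]) (auto simp: w_def)
  also have "\<dots> = (\<integral>\<^sup>+ s. ennreal (indicator {0..1} s * s powr e) \<partial>lborel)"
  proof (rule nn_integral_cong_AE)
    \<comment> \<open>For \<open>n = 1\<close> the two integrands differ at \<open>s = 0\<close>,
      again because \<open>0 ^ 0 = 1\<close> and \<open>0 powr 0 = 0\<close>.\<close>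
    have "AE s in lborel. s \<noteq> (0::real)" by (rule AE_lborel_singleton)
    then show "AE s in lborel. ennreal (w (1 - s)) = ennreal (indicator {0..1} s * s powr e)"
    proof eventually_elim
      case (elim s)
      show ?case
      proof (cases "s \<in> {0..1}")
        case True
        then have "s > 0" using elim by auto
        then have "(s ^ (n - 1)) powr q = s powr e"
          using n powr_realpow[of s "n - 1"] by (simp add: e_def powr_powr mult.commute flip: powr_realpow)
        then show ?thesis using True by (simp add: w_def)
      qed (auto simp: w_def)
    qed
  qed
  also have "\<dots> = ennreal (1 / (e + 1))"
  proof (rule nn_integral_has_integral_lborel)
    have "((\<lambda>s. if s \<in> {0..1} then s powr e else 0) has_integral (1 / (e + 1))) UNIV"
      using has_integral_powr_from_0[of e 1] e by (simp only: has_integral_restrict_UNIV) simp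
    moreover have "(\<lambda>s::real. if s \<in> {0..1} then s powr e else 0) = (\<lambda>s. indicator {0..1} s * s powr e)"
      by (auto simp: fun_eq_iff)
    ultimately show "((\<lambda>s. indicator {0..1} s * s powr e) has_integral (1 / (e + 1))) UNIV" by simp
  qed auto
  finally show ?thesis by (simp add: w_def e_def)
qed

lemma nn_integral_linear_powr:
  fixes c e :: real
  assumes c: "c > 0" and e: "e \<ge> 0"
  shows "(\<integral>\<^sup>+ s. ennreal ((1 + s * c) powr e) * indicator {0..1} s \<partial>lborel)
    = ennreal (((1 + c) powr (e + 1) - 1) / ((e + 1) * c))"
proof -
  have "(\<integral>\<^sup>+ s. ennreal ((1 + s * c) powr e) * indicator {0..1} s \<partial>lborel)
     = ennreal ((1 + 1 * c) powr (e + 1) / ((e + 1) * c) - (1 + 0 * c) powr (e + 1) / ((e + 1) * c))"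
  proof (rule nn_integral_FTC_Icc)
    fix s :: real assume s: "s \<in> {0..1}"
    then have "1 + s * c > 0" using c by (intro add_pos_nonneg) auto
    then show "((\<lambda>s. (1 + s * c) powr (e + 1) / ((e + 1) * c)) has_real_derivative (1 + s * c) powr e) (at s)"
      using c e by (auto intro!: derivative_eq_intros)
  qed auto
  then show ?thesis by (simp add: diff_divide_distrib)
qed

section \<open>Taylor expansion of the averaged function\<close>

locale poisson_cauchy = tau_params +
  fixes q :: real and f :: "real \<Rightarrow> real"
  assumes q: "q > 1" and pq: "1 / p + 1 / q = 1"
    and f: "C_n n f" and fn: "in_Lp p ((deriv ^^ n) f)"
begin

abbreviation "g \<equiv> (deriv ^^ n) f"

lemma deriv_funpow: "k < n \<Longrightarrow> ((deriv ^^ k) f has_real_derivative (deriv ^^ Suc k) f x) (at x)"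
  using f by (auto simp: C_n_def DERIV_deriv_iff_real_differentiable)

lemma continuous_deriv_funpow: "k \<le> n \<Longrightarrow> continuous_on UNIV ((deriv ^^ k) f)"
proof (cases "k = n")
  case False
  assume "k \<le> n"
  with False have "k < n" by simp
  then show ?thesis
    using DERIV_isCont[OF deriv_funpow] by (simp add: continuous_on_eq_continuous_at)
qed (use f in \<open>auto simp: C_n_def\<close>)

lemma deriv_funpow_measurable: "k \<le> n \<Longrightarrow> (deriv ^^ k) f \<in> borel_measurable borel"
  using continuous_deriv_funpow by (intro borel_measurable_continuous_onI)

lemma f_measurable [measurable]: "f \<in> borel_measurable borel"
  using deriv_funpow_measurable[of 0] by simp

lemma g_measurable [measurable]: "g \<in> borel_measurable borel"
  using deriv_funpow_measurable[of n] by simp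

text \<open>Parametrised over the unit interval, the formula treats both signs of \<open>h\<close>
  alike, and the remainders for all steps \<open>j * t\<close> share one weight and one domain, so
  that they combine under a single integral.\<close>

lemma taylor:
  "((\<lambda>s. (1 - s) ^ (n - 1) / fact (n - 1) * (h ^ n * g (x + s * h))) has_integral
     f (x + h) - (\<Sum>i<n. h ^ i / fact i * (deriv ^^ i) f x)) {0..1}"
proof -
  define Df where "Df = (\<lambda>m s. h ^ m * (deriv ^^ m) f (x + s * h))"
  have "((\<lambda>s. ((1 - s) ^ (n - 1) / fact (n - 1)) *\<^sub>R Df n s) has_integral
     Df 0 1 - (\<Sum>i<n. ((1 - 0) ^ i / fact i) *\<^sub>R Df i 0)) {0..1}"
  proof (rule Taylor_has_integral)
    fix m and t :: real assume "m < n"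
    have "((deriv ^^ m) f has_real_derivative (deriv ^^ Suc m) f (x + t * h)) (at (x + t * h))"
      by (rule deriv_funpow) fact
    then have "((\<lambda>s. (deriv ^^ m) f (x + s * h)) has_real_derivative (deriv ^^ Suc m) f (x + t * h) * h) (at t within {0..1})"
      by (rule DERIV_chain2) (auto intro!: derivative_eq_intros)
    then have "(Df m has_real_derivative h ^ m * ((deriv ^^ Suc m) f (x + t * h) * h)) (at t within {0..1})"
      unfolding Df_def by (rule DERIV_cmult)
    then show "(Df m has_vector_derivative Df (Suc m) t) (at t within {0..1})"
      unfolding has_real_derivative_iff_has_vector_derivative[symmetric] by (simp add: Df_def mult_ac)
  qed (use n in auto)
  then show ?thesis by (simp add: Df_def)
qed

text \<open>All orders up to \<open>n\<close> are subtracted, the odd ones included, although only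
  even ones occur in \<open>Delta_err\<close>: the remainder formula holds before integration, and
  the odd orders disappear only against the even kernel.\<close>

definition taylor_rem :: "real \<Rightarrow> real \<Rightarrow> real"
  where "taylor_rem x t = (\<Sum>j=0..r. alpha_coef r n j * f (x + real j * t)) - f x
    - (\<Sum>k=1..n. delta_coef r n k * (deriv ^^ k) f x * t ^ k / fact k)"

text \<open>The reason for the factor \<open>j powi (- n)\<close> in the coefficients: the Taylor
  remainder at step \<open>j * t\<close> carries \<open>j ^ n\<close>, and the product is the weight
  of the \<open>r\<close>-th difference.\<close>

lemma alpha_coef_times_power:
  assumes "j \<in> {1..r}"
  shows "alpha_coef r n j * real j ^ n = (-1) ^ (r - j) * real (r choose j)"
proof -
  have "real j powi (- int n) * real j ^ n = 1"
    using assms by (simp add: power_int_minus)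
  then show ?thesis using assms by (simp add: alpha_coef_def)
qed

lemma alpha_coef_0: "alpha_coef r n 0 = 1 - (\<Sum>j=1..r. alpha_coef r n j)"
  by (simp add: alpha_coef_def)

text \<open>The full alternating binomial sum is the \<open>r\<close>-th difference of a constant
  and vanishes for \<open>r \<ge> 1\<close>; what is left is minus its \<open>j = 0\<close>
  term.\<close>

lemma delta_coef_n: "delta_coef r n n = - ((-1) ^ r)"
proof -
  have "(\<Sum>j=0..r. (-1) ^ (r - j) * real (r choose j)) = fwd_diff r 0 (\<lambda>_. 1) 0"
    by (simp add: fwd_diff_def)
  also have "\<dots> = 0"
    using r by (cases r) (auto simp: fwd_diff_Suc diff1_def)
  finally have "(-1) ^ r + (\<Sum>j=1..r. (-1) ^ (r - j) * real (r choose j)) = 0"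
    by (subst (asm) sum.atLeast_Suc_atMost) auto
  moreover have "delta_coef r n n = (\<Sum>j=1..r. (-1) ^ (r - j) * real (r choose j))"
    unfolding delta_coef_def using alpha_coef_times_power by (intro sum.cong) auto
  ultimately show ?thesis by simp
qed

lemma taylor_rem_has_integral:
  "((\<lambda>s. (1 - s) ^ (n - 1) / fact (n - 1) * (t ^ n * fwd_diff r (s * t) g x)) has_integral taylor_rem x t) {0..1}"
proof -
  let ?w = "\<lambda>s::real. (1 - s) ^ (n - 1) / fact (n - 1)"
  let ?T = "\<lambda>j. (\<Sum>i<n. (real j * t) ^ i / fact i * (deriv ^^ i) f x)"
  \<comment> \<open>The Taylor formula yields the summands \<open>j \<ge> 1\<close> of the
    difference; the second line adds the missing \<open>j = 0\<close> summand
    \<open>(-1) ^ r * g x\<close>.\<close>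
  have "((\<lambda>s. (\<Sum>j=1..r. alpha_coef r n j * (?w s * ((real j * t) ^ n * g (x + s * (real j * t)))))
       + ((-1) ^ r * t ^ n * g x) * ?w s) has_integral
     (\<Sum>j=1..r. alpha_coef r n j * (f (x + real j * t) - ?T j)) + ((-1) ^ r * t ^ n * g x) * (1 / fact n)) {0..1}"
    by (intro has_integral_add has_integral_sum has_integral_mult_right taylor has_integral_weight n) auto
  moreover have "(\<Sum>j=1..r. alpha_coef r n j * (?w s * ((real j * t) ^ n * g (x + s * (real j * t)))))
       + ((-1) ^ r * t ^ n * g x) * ?w s = ?w s * (t ^ n * fwd_diff r (s * t) g x)" for s
  proof -
    have "(\<Sum>j=1..r. alpha_coef r n j * (?w s * ((real j * t) ^ n * g (x + s * (real j * t)))))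
      = (\<Sum>j=1..r. ?w s * t ^ n * ((-1) ^ (r - j) * real (r choose j) * g (x + real j * (s * t))))"
    proof (rule sum.cong)
      fix j assume j: "j \<in> {1..r}"
      have "alpha_coef r n j * (?w s * ((real j * t) ^ n * g (x + s * (real j * t))))
        = ?w s * t ^ n * ((alpha_coef r n j * real j ^ n) * g (x + real j * (s * t)))"
        by (simp add: power_mult_distrib mult_ac)
      then show "alpha_coef r n j * (?w s * ((real j * t) ^ n * g (x + s * (real j * t))))
        = ?w s * t ^ n * ((-1) ^ (r - j) * real (r choose j) * g (x + real j * (s * t)))"
        by (simp only: alpha_coef_times_power[OF j])
    qed simp
    also have "\<dots> = ?w s * t ^ n * (\<Sum>j=1..r. (-1) ^ (r - j) * real (r choose j) * g (x + real j * (s * t)))"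
      by (simp only: sum_distrib_left)
    also have "(\<Sum>j=1..r. (-1) ^ (r - j) * real (r choose j) * g (x + real j * (s * t)))
      = fwd_diff r (s * t) g x - (-1) ^ r * g x"
      unfolding fwd_diff_def by (subst (2) sum.atLeast_Suc_atMost) auto
    finally show ?thesis by (simp add: algebra_simps)
  qed
  moreover have "(\<Sum>j=1..r. alpha_coef r n j * (f (x + real j * t) - ?T j)) + ((-1) ^ r * t ^ n * g x) * (1 / fact n)
    = taylor_rem x t"
  proof -
    let ?d = "\<lambda>k. delta_coef r n k * (deriv ^^ k) f x * t ^ k / fact k"
    have "(\<Sum>j=1..r. alpha_coef r n j * ?T j) = (\<Sum>j=1..r. \<Sum>i<n. alpha_coef r n j * real j ^ i * ((deriv ^^ i) f x * t ^ i / fact i))"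
      unfolding sum_distrib_left by (intro sum.cong refl) (simp add: power_mult_distrib)
    also have "\<dots> = (\<Sum>i<n. ?d i)"
      unfolding delta_coef_def sum_distrib_right sum_divide_distrib
      by (subst sum.swap) (simp add: mult.assoc)
    finally have T: "(\<Sum>j=1..r. alpha_coef r n j * ?T j) = (\<Sum>i<n. ?d i)" .
    \<comment> \<open>The Taylor polynomials have orders \<open>0\<close> to \<open>n - 1\<close>,
      the sum in \<open>taylor_rem\<close> has orders \<open>1\<close> to \<open>n\<close>. Order 0
      is absorbed by \<open>alpha_coef_0\<close>; order \<open>n\<close> cancels against the
      integral of the added summand, by \<open>delta_coef_n\<close>.\<close>
    have "(\<Sum>i<n. ?d i) + ?d n = (\<Sum>i\<in>{0..n}. ?d i)"
      by (simp add: atLeast0AtMost lessThan_Suc_atMost[symmetric])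
    also have "\<dots> = ?d 0 + (\<Sum>k=1..n. ?d k)"
      by (subst sum.atLeast_Suc_atMost) auto
    finally have d: "(\<Sum>i<n. ?d i) = ?d 0 + (\<Sum>k=1..n. ?d k) - ?d n" by simp
    have d0: "?d 0 = (\<Sum>j=1..r. alpha_coef r n j) * f x" by (simp add: delta_coef_def)
    have F: "(\<Sum>j=0..r. alpha_coef r n j * f (x + real j * t))
      = f x - (\<Sum>j=1..r. alpha_coef r n j) * f x + (\<Sum>j=1..r. alpha_coef r n j * f (x + real j * t))"
      by (subst sum.atLeast_Suc_atMost) (auto simp: alpha_coef_0 algebra_simps)
    show ?thesis
      unfolding right_diff_distrib sum_subtractf T taylor_rem_def F d d0
      by (simp add: delta_coef_n)
  qed
  ultimately show ?thesis by simp
qed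

text \<open>The \<open>L\<^sub>q\<close> norm on the unit interval of the weight
  \<open>(1 - s) ^ (n - 1) / fact (n - 1)\<close>.\<close>

definition "taylor_const = 1 / (fact (n - 1) * (q * (real n - 1) + 1) powr (1 / q))"

lemma qn_pos: "q * (real n - 1) + 1 > 0"
  using q n by (intro add_nonneg_pos) auto

lemma taylor_const_pos: "taylor_const > 0"
  using qn_pos by (simp add: taylor_const_def)

lemma continuous_fwd_diff: "continuous_on A (\<lambda>s. fwd_diff r (s * t) g x)"
proof -
  have c: "continuous_on UNIV g" using continuous_deriv_funpow[of n] by simp
  have "continuous_on A (\<lambda>s. g (x + real j * (s * t)))" for j
    by (rule continuous_on_compose2[OF c]) (auto intro!: continuous_intros)
  then show ?thesis unfolding fwd_diff_def by (intro continuous_intros)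
qed

lemma fwd_diff_pair_measurable [measurable]:
  assumes [measurable]: "a \<in> borel_measurable M" "b \<in> borel_measurable M"
  shows "(\<lambda>z. fwd_diff r (a z) g (b z)) \<in> borel_measurable M"
  unfolding fwd_diff_def by measurable

text \<open>Hoelder's inequality in \<open>s\<close> with the weight in \<open>L\<^sub>q\<close>.
  The right side stays an extended nonnegative integral so that the integration over
  \<open>x\<close> can later be moved inside it.\<close>

lemma taylor_rem_powr_le:
  "ennreal (\<bar>taylor_rem x t\<bar> powr p) \<le> ennreal (taylor_const powr p * \<bar>t\<bar> powr (real n * p)) *
     (\<integral>\<^sup>+ s. ennreal (\<bar>fwd_diff r (s * t) g x\<bar> powr p) * indicator {0..1} s \<partial>lborel)"
proof -
  define D where "D = (\<lambda>s. fwd_diff r (s * t) g x)"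
  define a where "a = (\<lambda>s. indicator {0..1} s * \<bar>D s\<bar>)"
  define b where "b = (\<lambda>s::real. indicator {0..1} s * (1 - s) ^ (n - 1))"
  define \<phi> where "\<phi> = (\<lambda>s. (1 - s) ^ (n - 1) / fact (n - 1) * (t ^ n * D s))"
  have [measurable]: "D \<in> borel_measurable borel" unfolding D_def by measurable
  have [measurable]: "a \<in> borel_measurable borel" "b \<in> borel_measurable borel" "\<phi> \<in> borel_measurable borel"
    unfolding a_def b_def \<phi>_def by measurable
  have contD: "continuous_on {0..1} D" unfolding D_def by (rule continuous_fwd_diff)
  \<comment> \<open>Continuity of \<open>g\<close> makes the integral of
    \<open>\<bar>D s\<bar> powr p\<close> finite for every \<open>x\<close> and \<open>t\<close>, as
    \<open>nn_integral_Holder\<close> demands.\<close>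
  have "continuous_on {0..1} (\<lambda>s. \<bar>D s\<bar> powr p)"
    using contD p by (intro continuous_on_powr' continuous_intros) auto
  then have intA: "set_integrable lborel {0..1} (\<lambda>s. \<bar>D s\<bar> powr p)"
    by (rule borel_integrable_atLeastAtMost')
  define A where "A = (LBINT s:{0..1}. \<bar>D s\<bar> powr p)"
  have A0: "0 \<le> A" unfolding A_def set_lebesgue_integral_def by (intro integral_nonneg_AE) auto
  have A: "(\<integral>\<^sup>+ s. ennreal (\<bar>D s\<bar> powr p) * indicator {0..1} s \<partial>lborel) = ennreal A"
    unfolding A_def set_lebesgue_integral_def using intA
    by (subst nn_integral_eq_integral[symmetric])
      (auto simp: set_integrable_def intro!: nn_integral_cong split: split_indicator)
  have A': "(\<integral>\<^sup>+ s. ennreal (a s powr p) \<partial>lborel) = ennreal A"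
    unfolding A[symmetric] using p by (intro nn_integral_cong) (auto simp: a_def split: split_indicator)
  have "(\<integral>\<^sup>+ s. ennreal (a s * b s) \<partial>lborel) \<le> ennreal (A powr (1 / p) * (1 / (q * (real n - 1) + 1)) powr (1 / q))"
  proof (rule nn_integral_Holder[OF _ _ _ _ p q pq A' A0])
    show "(\<integral>\<^sup>+ s. ennreal (b s powr q) \<partial>lborel) = ennreal (1 / (q * (real n - 1) + 1))"
      unfolding b_def using q n by (intro nn_integral_weight_powr) auto
  qed (use qn_pos in \<open>auto simp: a_def b_def split: split_indicator\<close>)
  note holder = this
  have "continuous_on {0..1} \<phi>"
    unfolding \<phi>_def using contD by (intro continuous_intros) auto
  then have int: "set_integrable lborel {0..1} \<phi>" by (rule borel_integrable_atLeastAtMost')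
  have "taylor_rem x t = (LBINT s:{0..1}. \<phi> s)"
    using set_borel_integral_eq_integral(2)[OF int] integral_unique[OF taylor_rem_has_integral[of t x]]
    unfolding \<phi>_def D_def by (rule trans[symmetric])
  then have "ennreal \<bar>taylor_rem x t\<bar> \<le> (\<integral>\<^sup>+ s. ennreal (norm (indicator {0..1} s *\<^sub>R \<phi> s)) \<partial>lborel)"
    using integral_norm_bound_ennreal[OF int[unfolded set_integrable_def]]
    by (simp add: set_lebesgue_integral_def)
  also have "\<dots> = (\<integral>\<^sup>+ s. ennreal (\<bar>t\<bar> ^ n / fact (n - 1)) * ennreal (a s * b s) \<partial>lborel)"
    by (intro nn_integral_cong)
      (auto simp: a_def b_def \<phi>_def abs_mult power_abs ennreal_mult[symmetric] mult_ac split: split_indicator)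
  also have "\<dots> = ennreal (\<bar>t\<bar> ^ n / fact (n - 1)) * (\<integral>\<^sup>+ s. ennreal (a s * b s) \<partial>lborel)"
    by (rule nn_integral_cmult) auto
  also have "\<dots> \<le> ennreal (\<bar>t\<bar> ^ n / fact (n - 1)) * ennreal (A powr (1 / p) * (1 / (q * (real n - 1) + 1)) powr (1 / q))"
    by (intro mult_left_mono holder) auto
  also have "\<dots> = ennreal (\<bar>t\<bar> ^ n * taylor_const * A powr (1 / p))"
    using qn_pos by (simp add: ennreal_mult[symmetric] taylor_const_def powr_divide mult_ac)
  finally have "\<bar>taylor_rem x t\<bar> \<le> \<bar>t\<bar> ^ n * taylor_const * A powr (1 / p)"
    using taylor_const_pos by (subst (asm) ennreal_le_iff) auto
  then have "\<bar>taylor_rem x t\<bar> powr p \<le> (\<bar>t\<bar> ^ n * taylor_const * A powr (1 / p)) powr p"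
    using p by (intro powr_mono2) auto
  also have "\<dots> = (\<bar>t\<bar> ^ n) powr p * taylor_const powr p * A"
    using p A0 taylor_const_pos by (simp add: powr_mult powr_powr)
  also have "(\<bar>t\<bar> ^ n) powr p = \<bar>t\<bar> powr (real n * p)"
    using n p by (cases "t = 0") (simp_all add: powr_realpow[symmetric] powr_powr)
  finally show ?thesis
    using taylor_const_pos A0 unfolding A[unfolded D_def]
    by (simp add: ennreal_mult[symmetric] ennreal_leI mult_ac)
qed

section \<open>The error term\<close>

lemma taylor_rem_measurable [measurable]:
  assumes [measurable]: "a \<in> borel_measurable M" "b \<in> borel_measurable M"
  shows "(\<lambda>z. taylor_rem (a z) (b z)) \<in> borel_measurable M"
proof -
  have [measurable]: "(\<lambda>z. (deriv ^^ k) f (a z)) \<in> borel_measurable M" if "k \<in> {1..n}" for k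
    using that by (intro measurable_compose[OF _ deriv_funpow_measurable]) auto
  show ?thesis unfolding taylor_rem_def by measurable
qed

definition "rem_const = taylor_const powr p * (2 * tau_const r n \<alpha> \<beta> p / (real r * p + 1))"

lemma rem_const_pos: "rem_const > 0"
  using taylor_const_pos tau_const_pos p r
  unfolding rem_const_def by (intro mult_pos_pos divide_pos_pos) (auto intro: add_nonneg_pos)

text \<open>The differences can be bounded only after integration over \<open>x\<close>, so that
  integral is moved innermost, first past \<open>u\<close> and then past \<open>s\<close>.
  Integrating over \<open>s\<close> and then over \<open>u\<close> leaves \<tau>.\<close>

lemma nn_integral_taylor_rem_le:
  assumes \<xi>: "\<xi> > 0" and \<Omega>: "0 \<le> \<Omega>"
    and bound: "\<And>t. \<bar>t\<bar> \<le> \<xi> \<Longrightarrow> nn_Lp p (fwd_diff r t g) \<le> ennreal \<Omega>"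
  shows "(\<integral>\<^sup>+ x. \<integral>\<^sup>+ u. ennreal (\<bar>taylor_rem x (\<xi> * u)\<bar> powr p * kern \<alpha> (p * \<beta> / 2) u) \<partial>lborel \<partial>lborel)
    \<le> ennreal (rem_const * \<xi> powr (real n * p) * \<Omega>)"
proof -
  define C where "C = taylor_const powr p"
  have C: "C \<ge> 0" by (simp add: C_def)
  define K where "K = (\<lambda>u. C * \<bar>\<xi> * u\<bar> powr (real n * p) * kern \<alpha> (p * \<beta> / 2) u)"
  have [measurable]: "K \<in> borel_measurable borel" unfolding K_def by measurable
  have K: "0 \<le> K u" for u using C by (simp add: K_def)
  define F where "F = (\<lambda>x u s. ennreal (\<bar>fwd_diff r (s * (\<xi> * u)) g x\<bar> powr p) * indicator {0..1::real} s)"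
  have [measurable]: "(\<lambda>z. F (a z) (b z) (c z)) \<in> borel_measurable M"
    if [measurable]: "a \<in> borel_measurable M" "b \<in> borel_measurable M" "c \<in> borel_measurable M" for a b c and M :: "'z measure"
    unfolding F_def by measurable
  \<comment> \<open>Passing from step \<xi> to step \<open>s * (\<xi> * u)\<close> costs
    \<open>(1 + s * \<bar>u\<bar>) powr (r * p)\<close>: the scale \<xi> cancels.\<close>
  have inner: "(\<integral>\<^sup>+ x. \<integral>\<^sup>+ s. F x u s \<partial>lborel \<partial>lborel)
     \<le> ennreal (\<Omega> * (((1 + \<bar>u\<bar>) powr (real r * p + 1) - 1) / ((real r * p + 1) * \<bar>u\<bar>)))" if u: "u \<noteq> 0" for u
  proof -
    have "(\<integral>\<^sup>+ x. \<integral>\<^sup>+ s. F x u s \<partial>lborel \<partial>lborel) = (\<integral>\<^sup>+ s. \<integral>\<^sup>+ x. F x u s \<partial>lborel \<partial>lborel)"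
      by (rule lborel_pair.Fubini') measurable
    also have "\<dots> = (\<integral>\<^sup>+ s. nn_Lp p (fwd_diff r (s * (\<xi> * u)) g) * indicator {0..1} s \<partial>lborel)"
      unfolding F_def nn_Lp_def by (intro nn_integral_cong nn_integral_multc) auto
    also have "\<dots> \<le> (\<integral>\<^sup>+ s. ennreal \<Omega> * (ennreal ((1 + s * \<bar>u\<bar>) powr (real r * p)) * indicator {0..1} s) \<partial>lborel)"
    proof (rule nn_integral_mono)
      fix s :: real
      have "nn_Lp p (fwd_diff r (s * (\<xi> * u)) g) \<le> ennreal ((1 + \<bar>s * (\<xi> * u)\<bar> / \<xi>) powr (real r * p)) * ennreal \<Omega>"
        using p \<xi> bound by (intro nn_Lp_fwd_diff_scale) auto
      moreover have "\<bar>s * (\<xi> * u)\<bar> / \<xi> = \<bar>s\<bar> * \<bar>u\<bar>" using \<xi> by (simp add: abs_mult)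
      ultimately show "nn_Lp p (fwd_diff r (s * (\<xi> * u)) g) * indicator {0..1} s
        \<le> ennreal \<Omega> * (ennreal ((1 + s * \<bar>u\<bar>) powr (real r * p)) * indicator {0..1} s)"
        by (auto simp: mult.commute split: split_indicator)
    qed
    also have "\<dots> = ennreal \<Omega> * ennreal (((1 + \<bar>u\<bar>) powr (real r * p + 1) - 1) / ((real r * p + 1) * \<bar>u\<bar>))"
      using u p by (subst nn_integral_cmult) (auto simp: nn_integral_linear_powr)
    also have "\<dots> = ennreal (\<Omega> * (((1 + \<bar>u\<bar>) powr (real r * p + 1) - 1) / ((real r * p + 1) * \<bar>u\<bar>)))"
      using \<Omega> by (rule ennreal_mult'[symmetric])
    finally show ?thesis .
  qed
  have "(\<integral>\<^sup>+ x. \<integral>\<^sup>+ u. ennreal (\<bar>taylor_rem x (\<xi> * u)\<bar> powr p * kern \<alpha> (p * \<beta> / 2) u) \<partial>lborel \<partial>lborel)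
     \<le> (\<integral>\<^sup>+ x. \<integral>\<^sup>+ u. ennreal (K u) * (\<integral>\<^sup>+ s. F x u s \<partial>lborel) \<partial>lborel \<partial>lborel)"
  proof (intro nn_integral_mono)
    fix x u :: real
    have "ennreal (\<bar>taylor_rem x (\<xi> * u)\<bar> powr p) * ennreal (kern \<alpha> (p * \<beta> / 2) u) \<le>
       ennreal (C * \<bar>\<xi> * u\<bar> powr (real n * p)) * (\<integral>\<^sup>+ s. F x u s \<partial>lborel) * ennreal (kern \<alpha> (p * \<beta> / 2) u)"
      unfolding F_def C_def by (intro mult_right_mono taylor_rem_powr_le) auto
    then show "ennreal (\<bar>taylor_rem x (\<xi> * u)\<bar> powr p * kern \<alpha> (p * \<beta> / 2) u) \<le> ennreal (K u) * (\<integral>\<^sup>+ s. F x u s \<partial>lborel)"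
      using C by (simp add: K_def ennreal_mult mult_ac)
  qed
  also have "\<dots> = (\<integral>\<^sup>+ u. \<integral>\<^sup>+ x. ennreal (K u) * (\<integral>\<^sup>+ s. F x u s \<partial>lborel) \<partial>lborel \<partial>lborel)"
    by (rule lborel_pair.Fubini'[symmetric]) measurable
  also have "\<dots> = (\<integral>\<^sup>+ u. ennreal (K u) * (\<integral>\<^sup>+ x. \<integral>\<^sup>+ s. F x u s \<partial>lborel \<partial>lborel) \<partial>lborel)"
    by (intro nn_integral_cong nn_integral_cmult) measurable
  also have "\<dots> \<le> (\<integral>\<^sup>+ u. ennreal (C * \<xi> powr (real n * p) * \<Omega> / (real r * p + 1)) *
      ennreal (\<bar>u\<bar> powr (real n * p - 1) * ((1 + \<bar>u\<bar>) powr (real r * p + 1) - 1) * kern \<alpha> (p * \<beta> / 2) u) \<partial>lborel)"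
  proof (rule nn_integral_mono_AE)
    have "AE u in lborel. u \<noteq> (0::real)" by (rule AE_lborel_singleton)
    then show "AE u in lborel. ennreal (K u) * (\<integral>\<^sup>+ x. \<integral>\<^sup>+ s. F x u s \<partial>lborel \<partial>lborel)
       \<le> ennreal (C * \<xi> powr (real n * p) * \<Omega> / (real r * p + 1)) *
      ennreal (\<bar>u\<bar> powr (real n * p - 1) * ((1 + \<bar>u\<bar>) powr (real r * p + 1) - 1) * kern \<alpha> (p * \<beta> / 2) u)"
    proof eventually_elim
      case (elim u)
      let ?J = "(1 + \<bar>u\<bar>) powr (real r * p + 1) - 1"
      have J: "0 \<le> ?J" using p by (simp add: ge_one_powr_ge_zero)
      have "ennreal (K u) * (\<integral>\<^sup>+ x. \<integral>\<^sup>+ s. F x u s \<partial>lborel \<partial>lborel)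
         \<le> ennreal (K u) * ennreal (\<Omega> * (?J / ((real r * p + 1) * \<bar>u\<bar>)))"
        by (intro mult_left_mono inner elim) auto
      also have "\<dots> = ennreal (K u * (\<Omega> * (?J / ((real r * p + 1) * \<bar>u\<bar>))))"
        using K by (rule ennreal_mult'[symmetric])
      also have "K u * (\<Omega> * (?J / ((real r * p + 1) * \<bar>u\<bar>)))
        = (C * \<xi> powr (real n * p) * \<Omega> / (real r * p + 1)) *
          (\<bar>u\<bar> powr (real n * p - 1) * ?J * kern \<alpha> (p * \<beta> / 2) u)"
      proof -
        \<comment> \<open>One factor \<open>\<bar>u\<bar>\<close> is set apart to cancel the
          denominator left by the integral over \<open>s\<close>.\<close>
        have "\<bar>\<xi> * u\<bar> powr (real n * p) = \<xi> powr (real n * p) * (\<bar>u\<bar> powr (real n * p - 1) * \<bar>u\<bar>)"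
          using elim \<xi> by (simp add: abs_mult powr_mult powr_diff)
        then show ?thesis using elim by (simp add: K_def)
      qed
      also have "ennreal \<dots> = ennreal (C * \<xi> powr (real n * p) * \<Omega> / (real r * p + 1)) *
          ennreal (\<bar>u\<bar> powr (real n * p - 1) * ?J * kern \<alpha> (p * \<beta> / 2) u)"
        using C \<Omega> p by (intro ennreal_mult') (auto intro!: divide_nonneg_nonneg mult_nonneg_nonneg)
      finally show ?case .
    qed
  qed
  also have "\<dots> = ennreal (C * \<xi> powr (real n * p) * \<Omega> / (real r * p + 1)) * ennreal (2 * tau_const r n \<alpha> \<beta> p)"
    by (subst nn_integral_cmult) (auto simp: nn_integral_tau)
  also have "\<dots> = ennreal (C * \<xi> powr (real n * p) * \<Omega> / (real r * p + 1) * (2 * tau_const r n \<alpha> \<beta> p))"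
    using C \<Omega> p by (intro ennreal_mult'[symmetric]) (auto intro!: divide_nonneg_nonneg mult_nonneg_nonneg)
  also have "C * \<xi> powr (real n * p) * \<Omega> / (real r * p + 1) * (2 * tau_const r n \<alpha> \<beta> p)
    = rem_const * \<xi> powr (real n * p) * \<Omega>"
    by (simp add: rem_const_def C_def)
  finally show ?thesis .
qed

section \<open>Rescaled operator and exact formula for the error\<close>

lemma moment_condition: "real k \<le> real n \<Longrightarrow> (real k + 1) / (2 * real \<alpha>) < \<beta>"
proof -
  assume k: "real k \<le> real n"
  \<comment> \<open>Since \<open>r \<ge> 1\<close>, the hypothesis already bounds
    \<open>n + 1\<close> by \<open>\<alpha> * \<beta>\<close>, half of what the moments of order up
    to \<open>n\<close> permit.\<close>
  have "real n + 1 \<le> 1 / p + real n + real r" using r p by (simp add: add_increasing)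
  also have "\<dots> < real \<alpha> * \<beta>" using \<beta> \<alpha> by (simp add: field_simps)
  finally have "real k + 1 < real \<alpha> * \<beta>" using k by simp
  moreover have "0 \<le> real \<alpha> * \<beta>" using calculation by simp
  ultimately have "real k + 1 < 2 * (real \<alpha> * \<beta>)" by linarith
  then show ?thesis using \<alpha> by (simp add: field_simps)
qed

lemma half_kernel_condition: "(0 + 1) / (2 * real \<alpha>) < q * \<beta> / 2"
proof -
  have "real \<alpha> * \<beta> > 1"
  proof -
    have "1 \<le> 1 / p + real n + real r" using r p by (simp add: add_increasing)
    also have "\<dots> < real \<alpha> * \<beta>" using \<beta> \<alpha> by (simp add: field_simps)
    finally show ?thesis .
  qed
  moreover have "real \<alpha> * \<beta> * 1 < real \<alpha> * \<beta> * q"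
    using q calculation by (intro mult_strict_left_mono) auto
  ultimately have "1 < real \<alpha> * \<beta> * q" by linarith
  then show ?thesis using \<alpha> by (simp add: field_simps)
qed

text \<open>The value of \<open>W_const\<close> at \<open>\<xi> = 1\<close>; it normalises the
  kernel to total mass 1, as \<open>W1_moment_0\<close> records.\<close>

definition "W1 = Gamma \<beta> * real \<alpha> / (Gamma (1 / (2 * real \<alpha>)) * Gamma (\<beta> - 1 / (2 * real \<alpha>)))"

lemma Gammas_pos: "Gamma \<beta> > 0" "Gamma (1 / (2 * real \<alpha>)) > 0" "Gamma (\<beta> - 1 / (2 * real \<alpha>)) > 0"
proof -
  have *: "1 / (2 * real \<alpha>) < \<beta>" "0 < 1 / (2 * real \<alpha>)"
    using moment_condition[of 0] \<alpha> by simp_all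
  have "\<beta> > 0" using *(2,1) by (rule less_trans)
  then show "Gamma \<beta> > 0" by (rule Gamma_real_pos)
  show "Gamma (1 / (2 * real \<alpha>)) > 0" "Gamma (\<beta> - 1 / (2 * real \<alpha>)) > 0"
    using * by (auto intro!: Gamma_real_pos)
qed

lemma W1_pos: "W1 > 0"
  using Gammas_pos \<alpha> by (simp add: W1_def)

lemma W1_moment: "W1 * kern_moment \<alpha> \<beta> c = Gamma ((c + 1) / (2 * real \<alpha>)) * Gamma (\<beta> - (c + 1) / (2 * real \<alpha>))
    / (Gamma (1 / (2 * real \<alpha>)) * Gamma (\<beta> - 1 / (2 * real \<alpha>)))"
  using Gammas_pos \<alpha> by (simp add: W1_def kern_moment_def)

lemma W1_moment_0: "W1 * kern_moment \<alpha> \<beta> 0 = 1"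
  using Gammas_pos by (simp add: W1_moment)

text \<open>The powers of \<xi> cancel: 1 from the Jacobian, \<open>- 2 \<alpha> \<beta>\<close>
  from the kernel and \<open>2 \<alpha> \<beta> - 1\<close> from \<open>W_const\<close>.\<close>

lemma M_op_rescaled:
  assumes \<xi>: "\<xi> > 0"
  shows "M_op r n \<alpha> \<beta> \<xi> f x = W1 * (LINT u|lborel. (\<Sum>j=0..r. alpha_coef r n j * f (x + real j * (\<xi> * u))) * kern \<alpha> \<beta> u)"
proof -
  have k: "1 / ((\<xi> * u) ^ (2 * \<alpha>) + \<xi> ^ (2 * \<alpha>)) powr \<beta> = \<xi> powr (- (2 * real \<alpha> * \<beta>)) * kern \<alpha> \<beta> u" for u
  proof -
    have "(\<xi> * u) ^ (2 * \<alpha>) + \<xi> ^ (2 * \<alpha>) = \<xi> ^ (2 * \<alpha>) * (u ^ (2 * \<alpha>) + 1)"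
      by (simp add: power_mult_distrib distrib_left)
    also have "\<dots> powr \<beta> = (\<xi> ^ (2 * \<alpha>)) powr \<beta> * (u ^ (2 * \<alpha>) + 1) powr \<beta>"
      by (rule powr_mult)
    also have "(\<xi> ^ (2 * \<alpha>)) powr \<beta> = \<xi> powr (2 * real \<alpha> * \<beta>)"
      using \<xi> powr_realpow[of \<xi> "2 * \<alpha>"] by (metis of_nat_mult of_nat_numeral powr_powr)
    finally show ?thesis by (simp add: kern_def powr_minus_divide)
  qed
  let ?h = "\<lambda>t. \<Sum>j=0..r. alpha_coef r n j * f (x + real j * t)"
  have "(LINT t|lborel. ?h t / (t ^ (2 * \<alpha>) + \<xi> ^ (2 * \<alpha>)) powr \<beta>)
     = \<xi> * (LINT u|lborel. ?h (\<xi> * u) / ((\<xi> * u) ^ (2 * \<alpha>) + \<xi> ^ (2 * \<alpha>)) powr \<beta>)"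
    using \<xi> by (subst lborel_integral_real_affine[where c = \<xi> and t = 0]) auto
  also have "\<dots> = \<xi> * (LINT u|lborel. \<xi> powr (- (2 * real \<alpha> * \<beta>)) * (?h (\<xi> * u) * kern \<alpha> \<beta> u))"
  proof -
    have "?h (\<xi> * u) / ((\<xi> * u) ^ (2 * \<alpha>) + \<xi> ^ (2 * \<alpha>)) powr \<beta> = \<xi> powr (- (2 * real \<alpha> * \<beta>)) * (?h (\<xi> * u) * kern \<alpha> \<beta> u)" for u
    proof -
      have "?h (\<xi> * u) / ((\<xi> * u) ^ (2 * \<alpha>) + \<xi> ^ (2 * \<alpha>)) powr \<beta>
        = ?h (\<xi> * u) * (1 / ((\<xi> * u) ^ (2 * \<alpha>) + \<xi> ^ (2 * \<alpha>)) powr \<beta>)" by simp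
      then show ?thesis unfolding k by (simp only: mult_ac)
    qed
    then show ?thesis by (simp only:)
  qed
  also have "\<dots> = \<xi> powr (1 - 2 * real \<alpha> * \<beta>) * (LINT u|lborel. ?h (\<xi> * u) * kern \<alpha> \<beta> u)"
    using \<xi> by (simp add: powr_diff powr_minus_divide)
  finally have I: "(LINT t|lborel. ?h t / (t ^ (2 * \<alpha>) + \<xi> ^ (2 * \<alpha>)) powr \<beta>)
     = \<xi> powr (1 - 2 * real \<alpha> * \<beta>) * (LINT u|lborel. ?h (\<xi> * u) * kern \<alpha> \<beta> u)" .
  have "W_const \<alpha> \<beta> \<xi> = W1 * \<xi> powr (2 * real \<alpha> * \<beta> - 1)"
    by (simp add: W_const_def W1_def)
  moreover have "\<xi> powr (2 * real \<alpha> * \<beta> - 1) * \<xi> powr (1 - 2 * real \<alpha> * \<beta>) = 1"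
    using \<xi> by (simp add: powr_add[symmetric])
  ultimately have "W_const \<alpha> \<beta> \<xi> * \<xi> powr (1 - 2 * real \<alpha> * \<beta>) = W1"
    by (simp add: mult.assoc)
  then show ?thesis unfolding M_op_def I by (simp only: mult.assoc[symmetric])
qed

text \<open>The Bochner integral splits only over integrable pieces. The moments are integrable by
  the condition on \<beta>; for the remainder this is a hypothesis, to be discharged for almost
  every \<open>x\<close>.\<close>

lemma Delta_err_eq:
  assumes \<xi>: "\<xi> > 0" and int: "integrable lborel (\<lambda>u. taylor_rem x (\<xi> * u) * kern \<alpha> \<beta> u)"
  shows "Delta_err r n \<alpha> \<beta> \<xi> f x = W1 * (LINT u|lborel. taylor_rem x (\<xi> * u) * kern \<alpha> \<beta> u)"
proof -
  define c where "c = (\<lambda>k. delta_coef r n k * (deriv ^^ k) f x * \<xi> ^ k / fact k)"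
  define I where "I = (\<lambda>k. LINT u|lborel. u ^ k * kern \<alpha> \<beta> u)"
  have intk: "integrable lborel (\<lambda>u. u ^ k * kern \<alpha> \<beta> u)" if "k \<le> n" for k
    using that \<alpha> by (intro integrable_power_kern moment_condition) auto
  have split: "(\<Sum>j=0..r. alpha_coef r n j * f (x + real j * (\<xi> * u))) * kern \<alpha> \<beta> u
     = taylor_rem x (\<xi> * u) * kern \<alpha> \<beta> u + f x * (u ^ 0 * kern \<alpha> \<beta> u) + (\<Sum>k=1..n. c k * (u ^ k * kern \<alpha> \<beta> u))" for u
  proof -
    have "(\<Sum>k=1..n. c k * (u ^ k * kern \<alpha> \<beta> u))
      = (\<Sum>k=1..n. delta_coef r n k * (deriv ^^ k) f x * (\<xi> * u) ^ k / fact k) * kern \<alpha> \<beta> u"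
      unfolding sum_distrib_right c_def by (intro sum.cong) (auto simp: power_mult_distrib)
    then show ?thesis unfolding taylor_rem_def by (simp add: algebra_simps)
  qed
  have "has_bochner_integral lborel
      (\<lambda>u. taylor_rem x (\<xi> * u) * kern \<alpha> \<beta> u + f x * (u ^ 0 * kern \<alpha> \<beta> u) + (\<Sum>k=1..n. c k * (u ^ k * kern \<alpha> \<beta> u)))
      ((LINT u|lborel. taylor_rem x (\<xi> * u) * kern \<alpha> \<beta> u) + f x * I 0 + (\<Sum>k=1..n. c k * I k))"
    unfolding I_def
    by (intro has_bochner_integral_add has_bochner_integral_mult_right has_bochner_integral_sum
        has_bochner_integral_integrable int intk) auto
  then have "(LINT u|lborel. (\<Sum>j=0..r. alpha_coef r n j * f (x + real j * (\<xi> * u))) * kern \<alpha> \<beta> u)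
    = (LINT u|lborel. taylor_rem x (\<xi> * u) * kern \<alpha> \<beta> u) + f x * I 0 + (\<Sum>k=1..n. c k * I k)"
    unfolding split by (rule has_bochner_integral_integral_eq)
  also have "I 0 = kern_moment \<alpha> \<beta> 0"
    using integral_power_kern_even[of \<alpha> 0 \<beta>] \<alpha> moment_condition[of 0] by (simp add: I_def)
  also have "(\<Sum>k=1..n. c k * I k) = (\<Sum>m=1..n div 2. c (2 * m) * I (2 * m))"
  proof -
    \<comment> \<open>\<open>sum_even_indices\<close> asks for zeros at every odd index, whereas odd
      moments are treated only up to order \<open>n\<close>; the conditional supplies the zeros
      beyond.\<close>
    have "(\<Sum>k=1..n. c k * I k) = (\<Sum>k=1..n. if odd k then 0 else c k * I k)"
    proof (rule sum.cong)
      fix k assume "k \<in> {1..n}"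
      then show "c k * I k = (if odd k then 0 else c k * I k)"
        using integral_power_kern_odd[of \<alpha> k \<beta>] \<alpha> moment_condition[of k] by (simp add: I_def)
    qed simp
    also have "\<dots> = (\<Sum>m=1..n div 2. if odd (2 * m) then 0 else c (2 * m) * I (2 * m))"
      by (rule sum_even_indices) simp
    finally show ?thesis by simp
  qed
  also have "\<dots> = (\<Sum>m=1..n div 2. c (2 * m) * kern_moment \<alpha> \<beta> (2 * real m))"
  proof (rule sum.cong)
    fix m assume "m \<in> {1..n div 2}"
    then have "2 * m \<le> n" by auto
    then show "c (2 * m) * I (2 * m) = c (2 * m) * kern_moment \<alpha> \<beta> (2 * real m)"
      using integral_power_kern_even[of \<alpha> "2 * m" \<beta>] \<alpha> moment_condition[of "2 * m"] by (simp add: I_def)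
  qed simp
  finally have "M_op r n \<alpha> \<beta> \<xi> f x = W1 * (LINT u|lborel. taylor_rem x (\<xi> * u) * kern \<alpha> \<beta> u)
     + f x * (W1 * kern_moment \<alpha> \<beta> 0) + (\<Sum>m=1..n div 2. c (2 * m) * (W1 * kern_moment \<alpha> \<beta> (2 * real m)))"
    unfolding M_op_rescaled[OF \<xi>] by (simp add: distrib_left sum_distrib_left mult_ac)
  then show ?thesis
    unfolding Delta_err_def W1_moment_0 unfolding W1_moment c_def by (simp add: mult_ac)
qed

definition "holder_const = W1 * kern_moment \<alpha> (q * \<beta> / 2) 0 powr (1 / q)"

lemma kern_moment_half_pos: "kern_moment \<alpha> (q * \<beta> / 2) 0 > 0"
  using half_kernel_condition \<alpha> by (intro kern_moment_pos) auto

lemma holder_const_pos: "holder_const > 0"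
  using W1_pos kern_moment_half_pos by (simp add: holder_const_def)

text \<open>\<open>holder_const\<close> is \<open>W1\<close> times the \<open>L\<^sub>q\<close> norm
  of the half kernel. Writing \<alpha> and \<open>Gamma (1 / (2 * \<alpha>))\<close> as products of
  their powers \<open>1 / p\<close> and \<open>1 / q\<close> cancels the \<open>1 / q\<close> parts,
  which is why they enter the stated constant with exponent \<open>1 / p\<close>.\<close>

lemma bound_const_eq:
  "bound_const r n \<alpha> \<beta> p q \<xi> = holder_const * rem_const powr (1 / p) * \<xi> ^ n"
proof -
  define X where "X = Gamma (1 / (2 * real \<alpha>))"
  define Y where "Y = Gamma (q * \<beta> / 2 - 1 / (2 * real \<alpha>))"
  define Z where "Z = Gamma (q * \<beta> / 2)"
  define V where "V = Gamma (\<beta> - 1 / (2 * real \<alpha>))"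
  define a where "a = real \<alpha>"
  have h: "1 / (2 * real \<alpha>) < q * \<beta> / 2" "0 < 1 / (2 * real \<alpha>)"
    using half_kernel_condition \<alpha> by simp_all
  have "0 < q * \<beta> / 2" using h(2,1) by (rule less_trans)
  then have "Z > 0" unfolding Z_def by (rule Gamma_real_pos)
  moreover have "Y > 0" unfolding Y_def using h by (intro Gamma_real_pos) simp
  ultimately have pos: "X > 0" "Y > 0" "Z > 0" "V > 0" "a > 0"
    using Gammas_pos \<alpha> by (auto simp: X_def V_def a_def)
  have split: "y = y powr (1 / p) * y powr (1 / q)" if "y > 0" for y
    using that pq by (simp add: powr_add[symmetric])
  have hc: "holder_const = Gamma \<beta> * a powr (1 / p) * Y powr (1 / q) / (Z powr (1 / q) * X powr (1 / p) * V)"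
  proof -
    have "holder_const = Gamma \<beta> * a / (X * V) * (X * Y / (a * Z)) powr (1 / q)"
      by (simp add: holder_const_def W1_def kern_moment_def X_def Y_def Z_def V_def a_def)
    also have "\<dots> = Gamma \<beta> * a / (X * V) * (X powr (1 / q) * Y powr (1 / q) / (a powr (1 / q) * Z powr (1 / q)))"
      using pos by (simp add: powr_mult powr_divide)
    also have "\<dots> = Gamma \<beta> * (a powr (1 / p) * a powr (1 / q)) / (X powr (1 / p) * X powr (1 / q) * V)
        * (X powr (1 / q) * Y powr (1 / q) / (a powr (1 / q) * Z powr (1 / q)))"
      using split[of a] split[of X] pos by simp
    also have "\<dots> = Gamma \<beta> * a powr (1 / p) * Y powr (1 / q) / (Z powr (1 / q) * X powr (1 / p) * V)"
      using pos by (simp add: field_simps)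
    finally show ?thesis .
  qed
  have rp: "real r * p + 1 > 0" using p by (intro add_nonneg_pos) auto
  have "rem_const powr (1 / p) = taylor_const * (2 powr (1 / p) * tau_const r n \<alpha> \<beta> p powr (1 / p) / (real r * p + 1) powr (1 / p))"
    using taylor_const_pos tau_const_pos p rp
    by (simp add: rem_const_def powr_mult powr_divide powr_powr)
  then show ?thesis
    unfolding hc taylor_const_def bound_const_def X_def Y_def Z_def V_def a_def
    by (simp add: powr_mult mult_ac)
qed

text \<open>Hoelder's inequality in \<open>u\<close>, one half kernel staying with the remainder.
  The same bound also proves the integrability that \<open>Delta_err_eq\<close> requires.\<close>

lemma Delta_err_powr_le:
  assumes \<xi>: "\<xi> > 0"
    and fin: "(\<integral>\<^sup>+ u. ennreal (\<bar>taylor_rem x (\<xi> * u)\<bar> powr p * kern \<alpha> (p * \<beta> / 2) u) \<partial>lborel) = ennreal A" "0 \<le> A"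
  shows "\<bar>Delta_err r n \<alpha> \<beta> \<xi> f x\<bar> powr p \<le> holder_const powr p * A"
proof -
  define K where "K = kern_moment \<alpha> (q * \<beta> / 2) 0"
  have K: "K > 0" unfolding K_def by (rule kern_moment_half_pos)
  \<comment> \<open>At \<open>u = 0\<close> the factor \<open>\<bar>u\<bar> powr 0\<close> is 0, not
    1.\<close>
  have "AE u in lborel. u \<noteq> (0::real)" by (rule AE_lborel_singleton)
  then have "(\<integral>\<^sup>+ u. ennreal (kern \<alpha> (\<beta> / 2) u powr q) \<partial>lborel) = (\<integral>\<^sup>+ u. ennreal (\<bar>u\<bar> powr 0 * kern \<alpha> (q * \<beta> / 2) u) \<partial>lborel)"
    by (intro nn_integral_cong_AE) (erule eventually_mono, simp add: kern_powr)
  also have "\<dots> = ennreal K"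
    unfolding K_def using half_kernel_condition \<alpha> by (intro nn_integral_kern) auto
  finally have Kq: "(\<integral>\<^sup>+ u. ennreal (kern \<alpha> (\<beta> / 2) u powr q) \<partial>lborel) = ennreal K" .
  have "(\<integral>\<^sup>+ u. ennreal ((\<bar>taylor_rem x (\<xi> * u)\<bar> * kern \<alpha> (\<beta> / 2) u) * kern \<alpha> (\<beta> / 2) u) \<partial>lborel)
     \<le> ennreal (A powr (1 / p) * K powr (1 / q))"
    using fin K Kq by (intro nn_integral_Holder p q pq) (auto simp: powr_mult kern_powr)
  also have "(\<integral>\<^sup>+ u. ennreal ((\<bar>taylor_rem x (\<xi> * u)\<bar> * kern \<alpha> (\<beta> / 2) u) * kern \<alpha> (\<beta> / 2) u) \<partial>lborel)
    = (\<integral>\<^sup>+ u. ennreal (norm (taylor_rem x (\<xi> * u) * kern \<alpha> \<beta> u)) \<partial>lborel)"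
    by (intro nn_integral_cong) (simp add: mult.assoc kern_mult abs_mult)
  finally have le: "(\<integral>\<^sup>+ u. ennreal (norm (taylor_rem x (\<xi> * u) * kern \<alpha> \<beta> u)) \<partial>lborel) \<le> ennreal (A powr (1 / p) * K powr (1 / q))" .
  then have int: "integrable lborel (\<lambda>u. taylor_rem x (\<xi> * u) * kern \<alpha> \<beta> u)"
    by (intro integrableI_bounded) (auto simp: le_less_trans)
  have "ennreal \<bar>LINT u|lborel. taylor_rem x (\<xi> * u) * kern \<alpha> \<beta> u\<bar> \<le> ennreal (A powr (1 / p) * K powr (1 / q))"
    using order_trans[OF integral_norm_bound_ennreal[OF int] le] by simp
  then have "\<bar>LINT u|lborel. taylor_rem x (\<xi> * u) * kern \<alpha> \<beta> u\<bar> \<le> A powr (1 / p) * K powr (1 / q)"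
    by (subst (asm) ennreal_le_iff) auto
  then have "\<bar>Delta_err r n \<alpha> \<beta> \<xi> f x\<bar> \<le> W1 * (A powr (1 / p) * K powr (1 / q))"
    unfolding Delta_err_eq[OF \<xi> int] using W1_pos by (simp add: abs_mult)
  also have "\<dots> = holder_const * A powr (1 / p)" by (simp add: holder_const_def K_def)
  finally have "\<bar>Delta_err r n \<alpha> \<beta> \<xi> f x\<bar> powr p \<le> (holder_const * A powr (1 / p)) powr p"
    using p by (intro powr_mono2) auto
  also have "\<dots> = holder_const powr p * A"
    using p fin(2) by (simp add: powr_mult powr_powr)
  finally show ?thesis .
qed

lemma nn_Lp_Delta_err_le:
  assumes \<xi>: "\<xi> > 0" and \<omega>: "0 \<le> \<omega>"
    and bound: "\<And>t. \<bar>t\<bar> \<le> \<xi> \<Longrightarrow> nn_Lp p (fwd_diff r t g) \<le> ennreal (\<omega> powr p)"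
  shows "nn_Lp p (Delta_err r n \<alpha> \<beta> \<xi> f) \<le> ennreal ((bound_const r n \<alpha> \<beta> p q \<xi> * \<omega>) powr p)"
proof -
  define A where "A = (\<lambda>x. \<integral>\<^sup>+ u. ennreal (\<bar>taylor_rem x (\<xi> * u)\<bar> powr p * kern \<alpha> (p * \<beta> / 2) u) \<partial>lborel)"
  have [measurable]: "A \<in> borel_measurable lborel" unfolding A_def by measurable
  have le: "(\<integral>\<^sup>+ x. A x \<partial>lborel) \<le> ennreal (rem_const * \<xi> powr (real n * p) * \<omega> powr p)"
    unfolding A_def by (rule nn_integral_taylor_rem_le) (use \<xi> bound in auto)
  then have "(\<integral>\<^sup>+ x. A x \<partial>lborel) \<noteq> \<infinity>" by (auto simp: top_unique)
  \<comment> \<open>The points with \<open>A x = \<infinity>\<close>, where the integral in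
    \<open>M_op\<close> might be a mere default value, form a null set.\<close>
  then have "AE x in lborel. A x \<noteq> \<infinity>" by (intro nn_integral_PInf_AE) auto
  then have AE: "AE x in lborel. ennreal (\<bar>Delta_err r n \<alpha> \<beta> \<xi> f x\<bar> powr p) \<le> ennreal (holder_const powr p) * A x"
  proof eventually_elim
    case (elim x)
    then obtain a where a: "0 \<le> a" "A x = ennreal a" by (cases "A x") auto
    then have "\<bar>Delta_err r n \<alpha> \<beta> \<xi> f x\<bar> powr p \<le> holder_const powr p * a"
      by (intro Delta_err_powr_le \<xi>) (auto simp: A_def)
    then show ?case using a by (simp add: ennreal_mult[symmetric] ennreal_leI)
  qed
  have "nn_Lp p (Delta_err r n \<alpha> \<beta> \<xi> f) \<le> (\<integral>\<^sup>+ x. ennreal (holder_const powr p) * A x \<partial>lborel)"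
    unfolding nn_Lp_def by (rule nn_integral_mono_AE[OF AE])
  also have "\<dots> = ennreal (holder_const powr p) * (\<integral>\<^sup>+ x. A x \<partial>lborel)"
    by (rule nn_integral_cmult) auto
  also have "\<dots> \<le> ennreal (holder_const powr p) * ennreal (rem_const * \<xi> powr (real n * p) * \<omega> powr p)"
    by (intro mult_left_mono le) auto
  also have "\<dots> = ennreal (holder_const powr p * (rem_const * \<xi> powr (real n * p) * \<omega> powr p))"
    by (rule ennreal_mult'[symmetric]) simp
  also have "holder_const powr p * (rem_const * \<xi> powr (real n * p) * \<omega> powr p)
    = (bound_const r n \<alpha> \<beta> p q \<xi> * \<omega>) powr p"
  proof -
    have "\<xi> powr (real n * p) = (\<xi> ^ n) powr p"
      using \<xi> by (simp add: powr_powr flip: powr_realpow)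
    then show ?thesis
      unfolding bound_const_eq using \<xi> \<omega> p rem_const_pos holder_const_pos
      by (simp add: powr_mult powr_powr)
  qed
  finally show ?thesis .
qed

lemma bound_const_pos: "\<xi> > 0 \<Longrightarrow> bound_const r n \<alpha> \<beta> p q \<xi> > 0"
  unfolding bound_const_eq using holder_const_pos rem_const_pos by simp

text \<open>Since \<open>enn2real\<close> sends infinity to 0, finiteness of the modulus is what
  makes the passage to reals sound.\<close>

lemma omega_mod_dominates:
  assumes "\<bar>t\<bar> \<le> \<xi>"
  shows "nn_Lp p (fwd_diff r t g) \<le> ennreal (enn2real (omega_mod r p g \<xi>) powr p)"
proof -
  obtain K where K: "0 \<le> K" "\<And>\<xi>. omega_mod r p g \<xi> \<le> ennreal K"
    using omega_mod_bounded[OF fn p] by blast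
  have "Lp_norm p (fwd_diff r t g) \<le> omega_mod r p g \<xi>"
    unfolding omega_mod_def using assms by (intro SUP_upper) auto
  also have "\<dots> = ennreal (enn2real (omega_mod r p g \<xi>))"
    using K(2)[of \<xi>] by (simp add: ennreal_enn2real_if top_unique) (auto simp: top_unique)
  finally show ?thesis using p by (intro nn_Lp_leI) auto
qed

lemma Lp_norm_Delta_err_le:
  assumes \<xi>: "\<xi> > 0"
  shows "Lp_norm p (Delta_err r n \<alpha> \<beta> \<xi> f) \<le> ennreal (bound_const r n \<alpha> \<beta> p q \<xi>) * omega_mod r p g \<xi>"
proof -
  define \<omega> where "\<omega> = enn2real (omega_mod r p g \<xi>)"
  obtain K where K: "0 \<le> K" "\<And>\<xi>. omega_mod r p g \<xi> \<le> ennreal K"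
    using omega_mod_bounded[OF fn p] by blast
  have \<omega>: "omega_mod r p g \<xi> = ennreal \<omega>" "0 \<le> \<omega>"
    using K(2)[of \<xi>] by (auto simp: \<omega>_def ennreal_enn2real_if top_unique)
  have "Lp_norm p (Delta_err r n \<alpha> \<beta> \<xi> f) \<le> ennreal (bound_const r n \<alpha> \<beta> p q \<xi> * \<omega>)"
    using nn_Lp_Delta_err_le[OF \<xi> \<omega>(2)] omega_mod_dominates p \<omega>(2) bound_const_pos[OF \<xi>]
    by (intro Lp_norm_leI) (auto simp: \<omega>_def)
  then show ?thesis using \<omega> bound_const_pos[OF \<xi>] by (simp add: ennreal_mult)
qed

section \<open>Convergence as \<xi> tends to 0\<close>

lemma Lp_norm_Delta_err_bound:
  obtains K where "0 \<le> K" "\<And>\<xi>. \<xi> > 0 \<Longrightarrow> Lp_norm p (Delta_err r n \<alpha> \<beta> \<xi> f) \<le> ennreal (K * \<xi> ^ n)"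
proof -
  obtain K where K: "0 \<le> K" "\<And>\<xi>. omega_mod r p g \<xi> \<le> ennreal K"
    using omega_mod_bounded[OF fn p] by blast
  define K' where "K' = holder_const * rem_const powr (1 / p) * K"
  have "Lp_norm p (Delta_err r n \<alpha> \<beta> \<xi> f) \<le> ennreal (K' * \<xi> ^ n)" if \<xi>: "\<xi> > 0" for \<xi>
  proof -
    have "Lp_norm p (Delta_err r n \<alpha> \<beta> \<xi> f) \<le> ennreal (bound_const r n \<alpha> \<beta> p q \<xi>) * ennreal K"
      using Lp_norm_Delta_err_le[OF \<xi>] by (rule order_trans) (intro mult_left_mono K, auto)
    also have "\<dots> = ennreal (bound_const r n \<alpha> \<beta> p q \<xi> * K)"
      using bound_const_pos[OF \<xi>] by (intro ennreal_mult'[symmetric]) simp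
    finally show ?thesis by (simp add: bound_const_eq K'_def mult_ac)
  qed
  moreover have "0 \<le> K'" using holder_const_pos K by (simp add: K'_def)
  ultimately show ?thesis using that by blast
qed

lemma Delta_err_tendsto_0: "((\<lambda>\<xi>. Lp_norm p (Delta_err r n \<alpha> \<beta> \<xi> f)) \<longlongrightarrow> 0) (at_right 0)"
proof -
  obtain K where K: "\<And>\<xi>. \<xi> > 0 \<Longrightarrow> Lp_norm p (Delta_err r n \<alpha> \<beta> \<xi> f) \<le> ennreal (K * \<xi> ^ n)"
    using Lp_norm_Delta_err_bound by blast
  have "((\<lambda>\<xi>::real. K * \<xi> ^ n) \<longlongrightarrow> K * 0 ^ n) (at_right 0)"
    by (intro tendsto_intros)
  then have "((\<lambda>\<xi>::real. K * \<xi> ^ n) \<longlongrightarrow> 0) (at_right 0)" using n by (simp add: power_0_left)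
  then show ?thesis by (rule Lp_norm_tendsto_0) (rule K)
qed

lemma M_op_measurable [measurable]: "M_op r n \<alpha> \<beta> \<xi> f \<in> borel_measurable borel"
  unfolding M_op_def by measurable

text \<open>Each correction term is a fixed \<open>L\<^sub>p\<close> function times a positive power
  of \<xi>, and the error tends to 0 as well; \<open>nn_Lp_sum_le\<close> adds up the finitely many
  \<open>p\<close>-th powers.\<close>

lemma M_op_tendsto:
  assumes Lp: "\<And>m. m \<in> {1..n div 2} \<Longrightarrow> in_Lp p ((deriv ^^ (2 * m)) f)"
  shows "((\<lambda>\<xi>. Lp_norm p (\<lambda>x. M_op r n \<alpha> \<beta> \<xi> f x - f x)) \<longlongrightarrow> 0) (at_right 0)"
proof -
  define N where "N = n div 2"
  define c where "c = (\<lambda>m. delta_coef r n (2 * m) / fact (2 * m)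
         * (Gamma ((2 * real m + 1) / (2 * real \<alpha>)) * Gamma (\<beta> - (2 * real m + 1) / (2 * real \<alpha>)))
         / (Gamma (1 / (2 * real \<alpha>)) * Gamma (\<beta> - 1 / (2 * real \<alpha>))))"
  \<comment> \<open>Index 0, free because the corrections start at \<open>m = 1\<close>, holds the
    error, so that a single sum covers all the terms.\<close>
  define h where "h = (\<lambda>\<xi> m. if m = 0 then Delta_err r n \<alpha> \<beta> \<xi> f else (\<lambda>x. (c m * \<xi> ^ (2 * m)) * (deriv ^^ (2 * m)) f x))"
  have deriv_meas: "(deriv ^^ (2 * m)) f \<in> borel_measurable borel" if "m \<in> {1..N}" for m
    using that by (intro deriv_funpow_measurable) (auto simp: N_def)
  have sum_meas: "(\<lambda>x. \<Sum>m=1..N. (c m * \<xi> ^ (2 * m)) * (deriv ^^ (2 * m)) f x) \<in> borel_measurable borel" for \<xi>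
    using deriv_meas by (intro borel_measurable_sum borel_measurable_times) auto
  have Delta: "Delta_err r n \<alpha> \<beta> \<xi> f = (\<lambda>x. M_op r n \<alpha> \<beta> \<xi> f x - f x - (\<Sum>m=1..N. (c m * \<xi> ^ (2 * m)) * (deriv ^^ (2 * m)) f x))" for \<xi>
    by (auto simp: Delta_err_def c_def N_def fun_eq_iff intro!: sum.cong)
  have Delta_meas: "Delta_err r n \<alpha> \<beta> \<xi> f \<in> borel_measurable borel" for \<xi>
    unfolding Delta using sum_meas by (intro borel_measurable_diff) auto
  have h_meas: "h \<xi> m \<in> borel_measurable borel" if "m \<in> {0..N}" for \<xi> m
    using that Delta_meas deriv_meas by (auto simp: h_def)
  have decomp: "(\<lambda>x. M_op r n \<alpha> \<beta> \<xi> f x - f x) = (\<lambda>x. \<Sum>m=0..N. h \<xi> m x)" for \<xi>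
    by (subst sum.atLeast_Suc_atMost) (auto simp: h_def Delta fun_eq_iff)
  obtain K where K: "0 \<le> K" "\<And>\<xi>. \<xi> > 0 \<Longrightarrow> Lp_norm p (Delta_err r n \<alpha> \<beta> \<xi> f) \<le> ennreal (K * \<xi> ^ n)"
    using Lp_norm_Delta_err_bound by blast
  have "\<exists>G. 0 \<le> G \<and> nn_Lp p ((deriv ^^ (2 * m)) f) = ennreal G" if "m \<in> {1..N}" for m
    using in_Lp_nn_Lp_finite[OF Lp[of m]] that by (auto simp: N_def)
  then obtain G where G: "\<And>m. m \<in> {1..N} \<Longrightarrow> 0 \<le> G m" "\<And>m. m \<in> {1..N} \<Longrightarrow> nn_Lp p ((deriv ^^ (2 * m)) f) = ennreal (G m)"
    by metis
  define B where "B = (\<lambda>\<xi> m. if m = 0 then (K * \<xi> ^ n) powr p else \<bar>c m * \<xi> ^ (2 * m)\<bar> powr p * G m)"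
  have B: "nn_Lp p (h \<xi> m) \<le> ennreal (B \<xi> m)" "0 \<le> B \<xi> m" if m: "m \<in> {0..N}" and \<xi>: "\<xi> > 0" for \<xi> m
  proof -
    show "nn_Lp p (h \<xi> m) \<le> ennreal (B \<xi> m)"
    proof (cases "m = 0")
      case True
      then show ?thesis using nn_Lp_leI[OF K(2)[OF \<xi>]] p K(1) \<xi> by (simp add: h_def B_def)
    next
      case False
      then have m': "m \<in> {1..N}" using m by auto
      show ?thesis using False nn_Lp_cmult[OF deriv_meas[OF m'], of p "c m * \<xi> ^ (2 * m)"] G[OF m']
        by (simp add: h_def B_def ennreal_mult)
    qed
    show "0 \<le> B \<xi> m" using m G(1)[of m] by (auto simp: B_def)
  qed
  define b where "b = (\<lambda>\<xi>. (real (card {0..N}) powr (p - 1) * (\<Sum>m=0..N. B \<xi> m)) powr (1 / p))"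
  have le: "Lp_norm p (\<lambda>x. M_op r n \<alpha> \<beta> \<xi> f x - f x) \<le> ennreal (b \<xi>)" if \<xi>: "\<xi> > 0" for \<xi>
  proof (rule Lp_norm_leI)
    have "nn_Lp p (\<lambda>x. M_op r n \<alpha> \<beta> \<xi> f x - f x) \<le> ennreal (real (card {0..N}) powr (p - 1)) * (\<Sum>m=0..N. nn_Lp p (h \<xi> m))"
      unfolding decomp using p h_meas by (intro nn_Lp_sum_le) auto
    also have "\<dots> \<le> ennreal (real (card {0..N}) powr (p - 1)) * (\<Sum>m=0..N. ennreal (B \<xi> m))"
      using B \<xi> by (intro mult_left_mono sum_mono) auto
    also have "\<dots> = ennreal (real (card {0..N}) powr (p - 1) * (\<Sum>m=0..N. B \<xi> m))"
    proof -
      have "(\<Sum>m=0..N. ennreal (B \<xi> m)) = ennreal (\<Sum>m=0..N. B \<xi> m)"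
        using B(2)[OF _ \<xi>] by (intro sum_ennreal) auto
      then show ?thesis by (simp add: ennreal_mult')
    qed
    also have "real (card {0..N}) powr (p - 1) * (\<Sum>m=0..N. B \<xi> m) = b \<xi> powr p"
    proof -
      have "0 \<le> (\<Sum>m=0..N. B \<xi> m)" using B \<xi> by (intro sum_nonneg) auto
      then show ?thesis using p by (simp add: b_def powr_powr)
    qed
    finally show "nn_Lp p (\<lambda>x. M_op r n \<alpha> \<beta> \<xi> f x - f x) \<le> ennreal (b \<xi> powr p)" .
  qed (use p in \<open>auto simp: b_def\<close>)
  have B_tendsto: "((\<lambda>\<xi>. B \<xi> m) \<longlongrightarrow> 0) (at_right 0)" for m
  proof (cases "m = 0")
    case True
    \<comment> \<open>The base tends to 0, where \<open>tendsto_powr'\<close> asks for a positive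
      exponent and an eventually nonnegative base; the latter comes from approaching 0 from the
      right.\<close>
    have "((\<lambda>\<xi>. (K * \<xi> ^ n) powr p) \<longlongrightarrow> (K * 0 ^ n) powr p) (at_right 0)"
    proof (intro tendsto_powr' tendsto_intros disjI2 conjI)
      show "\<forall>\<^sub>F \<xi> in at_right 0. 0 \<le> K * \<xi> ^ n"
        using eventually_at_right_less[of "0::real"] by eventually_elim (use K(1) in simp)
    qed (use p in auto)
    then show ?thesis using True n by (simp add: B_def power_0_left)
  next
    case False
    have "((\<lambda>\<xi>. \<bar>c m * \<xi> ^ (2 * m)\<bar> powr p * G m) \<longlongrightarrow> \<bar>c m * 0 ^ (2 * m)\<bar> powr p * G m) (at_right 0)"
      using p by (intro tendsto_mult tendsto_const tendsto_powr' tendsto_rabs tendsto_power tendsto_ident_at) auto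
    then show ?thesis using False by (simp add: B_def power_0_left)
  qed
  have "(b \<longlongrightarrow> (real (card {0..N}) powr (p - 1) * (\<Sum>m=0..N. 0)) powr (1 / p)) (at_right 0)"
    unfolding b_def
  proof (intro tendsto_powr' tendsto_mult tendsto_const tendsto_sum B_tendsto disjI2 conjI)
    show "\<forall>\<^sub>F \<xi> in at_right 0. 0 \<le> real (card {0..N}) powr (p - 1) * (\<Sum>m=0..N. B \<xi> m)"
      using eventually_at_right_less[of 0] by eventually_elim (use B in \<open>auto intro!: mult_nonneg_nonneg sum_nonneg\<close>)
  qed (use p in auto)
  then have "(b \<longlongrightarrow> 0) (at_right 0)" by simp
  then show ?thesis using le by (rule Lp_norm_tendsto_0)
qed

end

theorem theorem1:
  fixes r n \<alpha> :: nat and p q \<beta> :: real and f :: "real \<Rightarrow> real"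
  assumes r: "r \<ge> 1" and n: "n \<ge> 1" and \<alpha>: "\<alpha> \<ge> 1"
    and p: "p > 1" and q: "q > 1" and pq: "1 / p + 1 / q = 1"
    and \<beta>: "\<beta> > (1 / real \<alpha>) * (1 / p + real n + real r)"
    and f: "C_n n f" and fn: "in_Lp p ((deriv ^^ n) f)"
  shows "set_integrable lborel {0<..} (tau_int1 r n \<alpha> \<beta> p)
       \<and> set_integrable lborel {0<..} (tau_int2 n \<alpha> \<beta> p)
       \<and> 0 < tau_const r n \<alpha> \<beta> p
       \<and> (\<forall>\<xi>>0. Lp_norm p (Delta_err r n \<alpha> \<beta> \<xi> f)
              \<le> ennreal (bound_const r n \<alpha> \<beta> p q \<xi>) * omega_mod r p ((deriv ^^ n) f) \<xi>)
       \<and> ((\<lambda>\<xi>. Lp_norm p (Delta_err r n \<alpha> \<beta> \<xi> f)) \<longlongrightarrow> 0) (at_right 0)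
       \<and> ((\<forall>m\<in>{1..n div 2}. in_Lp p ((deriv ^^ (2 * m)) f)) \<longrightarrow>
            ((\<lambda>\<xi>. Lp_norm p (\<lambda>x. M_op r n \<alpha> \<beta> \<xi> f x - f x)) \<longlongrightarrow> 0) (at_right 0))"
proof -
  interpret poisson_cauchy r n \<alpha> p \<beta> q f
    by standard (fact r n \<alpha> p \<beta> q pq f fn)+
  show ?thesis
    using tau_int1_integrable tau_int2_integrable tau_const_pos Lp_norm_Delta_err_le
      Delta_err_tendsto_0 M_op_tendsto by blast
qed

end
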